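(* Let $q>1$ be an odd integer and let $R$ be a commutative ring, not of characteristic $2$, that does not possess a homomorphic image isomorphic to $\mathbb{F}_3$, and such that $q-1\in U(R)$. Then the following assertions are equivalent: (1) For every positive integer $n$, every matrix in $\mathbb{M}_n(R)$ is a sum of an idempotent matrix and an invertible $q$-potent matrix. (2) There exists a positive integer $n$ such that each matrix in $\mathbb{M}_n(R)$ is a sum of an idempotent matrix and an invertible $q$-potent matrix. (3) For every positive integer $n$, every matrix in $\mathbb{M}_n(R)$ is a sum of an idempotent matrix and a $q$-potent matrix. (4) There exists a positive integer $n$ such that each matrix in $\mathbb{M}_n(R)$ is a sum of an idempotent matrix and a $q$-potent matrix. (5) The ring $R$ satisfies the identity $x^q=x$.
   Context: All rings are associative with unity. $U(R)$ is the group of units of $R$; the condition $q-1\in U(R)$ means that the image of the integer $q-1$ in $R$ is a unit. $\mathbb{F}_3$ is the field with $3$ elements, and $\mathbb{M}_n(R)$ is the ring of $n\times n$ matrices over $R$. A matrix $E$ is idempotent if $E^2=E$, and a matrix $B$ is $q$-potent if $B^q=B$. *)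

theory Defs
  imports "Jordan_Normal_Form.Matrix" "HOL-Library.Numeral_Type"
begin

definition idempotent_mat :: "'a :: semiring_1 mat \<Rightarrow> bool" where
  "idempotent_mat E \<longleftrightarrow> square_mat E \<and> E * E = E"

definition q_potent_mat :: "nat \<Rightarrow> 'a :: semiring_1 mat \<Rightarrow> bool" where
  "q_potent_mat q B \<longleftrightarrow> square_mat B \<and> B ^\<^sub>m q = B"

definition sum_idem_inv_q_potent :: "nat \<Rightarrow> nat \<Rightarrow> 'a :: semiring_1 mat \<Rightarrow> bool" where
  "sum_idem_inv_q_potent q n A \<longleftrightarrow>
     (\<exists>E \<in> carrier_mat n n. \<exists>V \<in> carrier_mat n n.
        idempotent_mat E \<and> invertible_mat V \<and> q_potent_mat q V \<and> A = E + V)"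

definition sum_idem_q_potent :: "nat \<Rightarrow> nat \<Rightarrow> 'a :: semiring_1 mat \<Rightarrow> bool" where
  "sum_idem_q_potent q n A \<longleftrightarrow>
     (\<exists>E \<in> carrier_mat n n. \<exists>V \<in> carrier_mat n n.
        idempotent_mat E \<and> q_potent_mat q V \<and> A = E + V)"

text \<open>The type \<^typ>\<open>3\<close> carries arithmetic modulo 3, so it is the field with three elements;
  a homomorphic image isomorphic to it amounts to a surjective unital homomorphism onto it.\<close>

definition has_F3_image :: "'a :: comm_ring_1 itself \<Rightarrow> bool" where
  "has_F3_image _ \<longleftrightarrow> (\<exists>h :: 'a \<Rightarrow> 3. comm_ring_hom h \<and> surj h)"

end

theory Submission
  imports Defs "HOL-Computational_Algebra.Polynomial" "HOL-Library.FuncSet" "HOL-Library.Function_Algebras"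
begin

text \<open>
Write \<open>f(t) = t\<^sup>q - t\<close>. Since \<open>q\<close> is odd, \<open>q - 1\<close> is even, so \<open>2\<close> is a unit along with \<open>q - 1\<close>.
The implications from (1) to (2), (3) and from those to (4) are immediate, so the content is
that (4) implies (5) and that (5) implies (1).

(4) implies (5). Split a scalar matrix, \<open>x I = E + V\<close>. Then \<open>V\<close> is \<open>x\<close> on the kernel of \<open>E\<close> and \<open>x - 1\<close> on
its image, so \<open>f(x) (I - E) = 0\<close> and \<open>f(x - 1) E = 0\<close> (\<open>scalar_mat_split\<close>). Applied to an \<open>x\<close> with
\<open>x\<^sup>2 = 0\<close> this forces \<open>x = 0\<close>, because then \<open>f(x) = - x\<close> and \<open>f(x - 1) = (q - 1) x\<close>; so the ring is
reduced. It also gives \<open>f(x) f(x - 1) = 0\<close> for all \<open>x\<close>. In a field this means that \<open>x\<close> or \<open>x - 1\<close> is a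
root of \<open>f\<close>, for every \<open>x\<close>. The nonzero roots of \<open>f\<close> form a group containing \<open>-1\<close>. If \<open>x\<close> were not a root,
then \<open>x - 1\<close> would be one, and as \<open>1/x\<close> is not a root either, \<open>1/x - 1 = -(x - 1)/x\<close> would be one; but
the quotient of these two nonzero roots is \<open>-x\<close>, and then \<open>x\<close> would be a root. The
lemma \<open>identity_of_scalar_splits\<close> carries this out in a reduced ring, multiplying everything by \<open>f(x)\<close>
instead of passing to a field.

(5) implies (1), over a field. Here \<open>F\<close> is a finite field of odd characteristic with at least five
elements, all of whose nonzero elements satisfy \<open>b\<^sup>N = 1\<close> for \<open>N = q - 1\<close>. It is enough to subtract an
idempotent from an operator \<open>T\<close> so that the difference is diagonalizable with nonzero eigenvalues
in \<open>F\<close>. The space splits into indecomposable \<open>T\<close>-invariant summands, and each of them is cyclic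
(\<open>indecomposable_cyclic\<close>, \<open>cyclic_split_projection\<close>). On a cyclic summand of dimension \<open>k\<close> there is
a basis \<open>w\<^sub>0, ..., w\<^sub>k\<^sub>-\<^sub>1\<close> in which \<open>T\<close> has subdiagonal entries \<open>1\<close>, any prescribed diagonal with the right
trace, and further nonzero entries only in the last column (\<open>hessenberg_basis\<close>). Every second
subdiagonal entry is put into the idempotent. What remains is a matrix of diagonal blocks of size
at most two together with the last column, and a suitable diagonal makes it diagonalizable
(\<open>cyclic_splits\<close>).

(5) implies (1), in general. Every idempotent of the ring decomposes it into a product, so solutions
of \<open>A = E + V\<close> on complementary pieces can be glued. Therefore the elements \<open>x\<close> for which \<open>x A = x (E + V)\<close>
is solvable with \<open>E\<^sup>2 = E\<close> and \<open>V\<^sup>N = I\<close> form an ideal, and if it were proper it would lie in a maximal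
ideal modulo which \<open>A\<close> has no splitting (\<open>splits_if_splits_mod_maximal\<close>). The residue fields satisfy the hypotheses of the
field case: \<open>2\<close> is invertible in them, and they are not the field with three elements.
\<close>

section \<open>Iterates on finite sets and extension of linear maps\<close>

lemma iterates_repeat:
  assumes "finite S" "\<And>x. x \<in> S \<Longrightarrow> f x \<in> S"
  shows "\<exists>i j. i < j \<and> (\<forall>x\<in>S. (f ^^ i) x = (f ^^ j) x)"
proof -
  have closed: "(f ^^ n) x \<in> S" if "x \<in> S" for n x
    using that assms(2) by (induction n) auto
  let ?r = "\<lambda>n. restrict (f ^^ n) S"
  have "range ?r \<subseteq> (S \<rightarrow>\<^sub>E S)" using closed by auto
  then have "finite (range ?r)" using assms(1) by (meson finite_PiE finite_subset)
  then have "\<not> inj ?r" using finite_imageD infinite_UNIV_nat by blast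
  then obtain i j where "?r i = ?r j" "i \<noteq> j" by (auto simp: inj_def)
  then have "\<forall>x\<in>S. (f ^^ i) x = (f ^^ j) x" by (metis restrict_apply')
  then show ?thesis using \<open>i \<noteq> j\<close> by (metis linorder_neqE_nat)
qed

text \<open>In the finite monoid of maps generated by \<open>f\<close> some positive power is idempotent. For a polynomial in
an operator on a finite space this produces an invariant direct summand, which is the source of
all decompositions below.\<close>

lemma iterates_idempotent:
  assumes "finite S" "\<And>x. x \<in> S \<Longrightarrow> f x \<in> S"
  shows "\<exists>j>0. \<forall>x\<in>S. (f ^^ j) ((f ^^ j) x) = (f ^^ j) x"
proof -
  obtain i j where ij: "i < j" and eq: "\<And>x. x \<in> S \<Longrightarrow> (f ^^ i) x = (f ^^ j) x"
    using iterates_repeat[of S f] assms by auto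
  define d where "d = j - i"
  have period: "(f ^^ (i + l + m * d)) x = (f ^^ (i + l)) x" if "x \<in> S" for l m x
  proof (induction m)
    case (Suc m)
    have "(f ^^ (i + l + Suc m * d)) x = (f ^^ (l + m * d + j)) x"
      using ij by (simp add: d_def add_ac)
    also have "\<dots> = (f ^^ (l + m * d + i)) x"
      by (simp only: funpow_add o_apply eq[OF that])
    finally show ?case using Suc by (simp add: add_ac)
  qed simp
  \<comment> \<open>A multiple of the period that is at least the preperiod.\<close>
  define e where "e = Suc i * d"
  have "0 < d" using ij by (simp add: d_def)
  then have "0 < e" "Suc i * 1 \<le> e" unfolding e_def by (auto intro: mult_le_mono2 simp del: mult_Suc)
  then have "i \<le> e" by simp
  have "(f ^^ e) ((f ^^ e) x) = (f ^^ e) x" if "x \<in> S" for x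
  proof -
    have "(f ^^ e) ((f ^^ e) x) = (f ^^ (i + (e - i) + e)) x"
      using \<open>i \<le> e\<close> by (simp add: funpow_add)
    also have "\<dots> = (f ^^ e) x"
      using period[OF that, of "e - i" "Suc i"] \<open>i \<le> e\<close> unfolding e_def[symmetric] by simp
    finally show ?thesis .
  qed
  then show ?thesis using \<open>0 < e\<close> by blast
qed

lemma (in vector_space_pair) linear_extend_family:
  fixes k :: nat
  assumes "\<And>u. (\<Sum>i<k. s1 (u i) (b i)) = 0 \<Longrightarrow> \<forall>i<k. u i = 0"
  shows "\<exists>f. Vector_Spaces.linear s1 s2 f \<and> (\<forall>i<k. f (b i) = y i)"
proof -
  have inj: "inj_on b {..<k}"
  proof (rule inj_onI, rule ccontr)
    fix i j assume ij: "i \<in> {..<k}" "j \<in> {..<k}" "b i = b j" "i \<noteq> j"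
    let ?u = "\<lambda>l. if l = i then 1 else if l = j then -1 else 0 :: 'a"
    have "(\<Sum>l<k. s1 (?u l) (b l)) = (\<Sum>l<k. (if l = i then b i else 0) + (if l = j then - b j else 0))"
      by (rule sum.cong) (use ij in auto)
    also have "\<dots> = b i + - b j"
      using ij(1,2) by (subst sum.distrib, subst (1 2) sum.delta) auto
    also have "\<dots> = 0" using ij(3) by simp
    finally show False using assms[of ?u] ij by auto
  qed
  have "vs1.independent (b ` {..<k})"
  proof (rule vs1.independent_if_scalars_zero)
    fix u x assume s: "(\<Sum>x\<in>b ` {..<k}. s1 (u x) x) = 0" and x: "x \<in> b ` {..<k}"
    have "(\<Sum>i<k. s1 (u (b i)) (b i)) = 0" using s inj by (simp add: sum.reindex)
    then show "u x = 0" using assms[of "\<lambda>i. u (b i)"] x by auto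
  qed simp
  from linear_independent_extend[OF this, of "\<lambda>x. y (inv_into {..<k} b x)"]
  show ?thesis using inj by (auto simp: inv_into_f_f)
qed

lemma (in vector_space) functional_extend_family:
  fixes k :: nat
  assumes "\<And>u. (\<Sum>i<k. scale (u i) (b i)) = 0 \<Longrightarrow> \<forall>i<k. u i = 0"
  shows "\<exists>f. Vector_Spaces.linear scale (*) f \<and> (\<forall>i<k. f (b i) = y i)"
proof -
  interpret functional: vector_space_pair scale "(*) :: 'a \<Rightarrow> 'a \<Rightarrow> 'a"
    by unfold_locales (simp_all add: algebra_simps)
  show ?thesis using assms by (rule functional.linear_extend_family)
qed

section \<open>A diagonal with prescribed trace\<close>

lemma alternating_sum:
  "(\<Sum>i<2 * m. if even i then p else 1 - p) = (of_nat m :: 'a::comm_ring_1)"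
  by (induction m) simp_all

text \<open>The diagonal to be prescribed on a cyclic summand of dimension \<open>k\<close> and trace \<open>\<tau>\<close>. Positions whose distance to the last one is odd start a
pair (these contribute the eigenvalue \<open>d i - 1\<close>), the others end a pair, and \<open>a\<close> becomes the last
eigenvalue. Inner eigenvalues alternate between \<open>p\<close> and \<open>-p\<close>, so that they cancel in the trace. The trace
is adjusted at the two ends: for even \<open>k\<close> by the first eigenvalue \<open>r\<close> and by \<open>a\<close>, for odd \<open>k\<close> by \<open>a\<close> and by
the diagonal entry \<open>\<epsilon> 0\<close> of the idempotent at the unpaired first position, which serves to keep \<open>a\<close>
nonzero. At most three values have to be avoided at each choice, hence the bound on the field.\<close>

lemma hessenberg_diagonal:
  fixes \<tau> :: "'f::field"
  assumes two: "(2 :: 'f) \<noteq> 0" and big: "\<And>x y z :: 'f. \<exists>a. a \<notin> {x, y, z}" and "0 < k"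
  obtains d a \<epsilon> where "(\<Sum>i<k. d i) = \<tau>" "a \<noteq> 0" "a = d (k - 1) - \<epsilon> (k - 1)"
    "\<And>i. \<epsilon> i * \<epsilon> i = \<epsilon> i" "\<And>i. 0 < i \<Longrightarrow> \<epsilon> i = 0"
    "\<And>i. i < k - 1 \<Longrightarrow> odd (k - 1 - i) \<Longrightarrow> d i - 1 \<noteq> 0 \<and> d i - 1 \<noteq> a"
    "\<And>i. i < k - 1 \<Longrightarrow> even (k - 1 - i) \<Longrightarrow>
       d i - \<epsilon> i \<noteq> 0 \<and> d i - \<epsilon> i \<noteq> a \<and> d i - \<epsilon> i \<noteq> d (Suc i) - 1"
proof (cases "even k")
  case True
  then obtain m where k: "k = 2 * m + 2" using \<open>0 < k\<close>
    by (metis add_Suc_right dvd_mult_div_cancel even_Suc gr0_implies_Suc mult_Suc_right numeral_2_eq_2 odd_Suc_div_two add.commute)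
  define t where "t = \<tau> - 1 - of_nat m"
  \<comment> \<open>Excluding \<open>t\<close> and \<open>t / 2\<close> makes \<open>r = t - a\<close> different from \<open>0\<close> and from \<open>a\<close>.\<close>
  obtain a where a: "a \<notin> {0, t, t / 2}" using big by blast
  define r where "r = t - a"
  have r: "r \<noteq> 0" "r \<noteq> a" using a two by (auto simp: r_def field_simps)
  obtain p where p: "p \<notin> {0, a, - a}" using big by blast
  then have pp: "p \<noteq> - p" using two by (metis add_eq_0_iff2 insertCI mult_2 mult_eq_0_iff)
  define d where "d i = (if i = 0 then r + 1 else if i = 2 * m + 1 then a else if odd i then p else 1 - p)" for i
  show thesis
  proof (rule that[of d a "\<lambda>_. 0"])
    have "(\<Sum>i<k. d i) = d 0 + (\<Sum>i<2 * m. d (Suc i)) + d (2 * m + 1)"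
      using sum.lessThan_Suc_shift[of d "2 * m"] by (simp add: k)
    also have "(\<Sum>i<2 * m. d (Suc i)) = (\<Sum>i<2 * m. if even i then p else 1 - p)"
      by (rule sum.cong) (auto simp: d_def)
    finally show "(\<Sum>i<k. d i) = \<tau>" unfolding alternating_sum by (simp add: d_def r_def t_def)
    show "a \<noteq> 0" using a by simp
    show "a = d (k - 1) - 0" by (simp add: d_def k)
    show "d i - 1 \<noteq> 0 \<and> d i - 1 \<noteq> a" if "i < k - 1" "odd (k - 1 - i)" for i
    proof -
      have "even i" "i < 2 * m + 1" using that by (auto simp: k)
      then show ?thesis using r p by (auto simp: d_def minus_equation_iff)
    qed
    show "d i - 0 \<noteq> 0 \<and> d i - 0 \<noteq> a \<and> d i - 0 \<noteq> d (Suc i) - 1" if "i < k - 1" "even (k - 1 - i)" for i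
    proof -
      have "odd i" "i < 2 * m" using that by (auto simp: k less_Suc_eq)
      then have "i \<noteq> 0" "Suc i \<noteq> 2 * m + 1" by (auto intro: ccontr)
      then show ?thesis using \<open>odd i\<close> \<open>i < 2 * m\<close> p pp by (auto simp: d_def)
    qed
  qed simp_all
next
  case False
  then obtain m where k: "k = 2 * m + 1" by (metis oddE)
  define e :: 'f where "e = (if \<tau> - of_nat m = 0 then 1 else 0)"
  define a where "a = \<tau> - of_nat m - e"
  have a: "a \<noteq> 0" by (auto simp: a_def e_def)
  obtain p where p: "p \<notin> {0, a, - a}" using big by blast
  then have pp: "p \<noteq> - p" using two by (metis add_eq_0_iff2 insertCI mult_2 mult_eq_0_iff)
  define \<epsilon> where "\<epsilon> i = (if i = 0 then e else 0)" for i :: nat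
  define d where "d i = (if i = 2 * m then a else if even i then p else 1 - p) + \<epsilon> i" for i
  show thesis
  proof (rule that[of d a \<epsilon>])
    have "(\<Sum>i<k. d i) = (\<Sum>i<2 * m + 1. if i = 2 * m then a else if even i then p else 1 - p)
        + (\<Sum>i<2 * m + 1. \<epsilon> i)"
      by (simp add: d_def sum.distrib k)
    also have "(\<Sum>i<2 * m + 1. \<epsilon> i) = e" by (simp add: \<epsilon>_def sum.delta)
    also have "(\<Sum>i<2 * m + 1. if i = 2 * m then a else if even i then p else 1 - p)
        = (\<Sum>i<2 * m. if even i then p else 1 - p) + a"
      by simp
    finally show "(\<Sum>i<k. d i) = \<tau>" unfolding alternating_sum by (simp add: a_def)
    show "a \<noteq> 0" by (rule a)
    show "a = d (k - 1) - \<epsilon> (k - 1)" by (simp add: d_def k)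
    show "\<epsilon> i * \<epsilon> i = \<epsilon> i" for i by (simp add: \<epsilon>_def e_def)
    show "\<epsilon> i = 0" if "0 < i" for i using that by (simp add: \<epsilon>_def)
    show "d i - 1 \<noteq> 0 \<and> d i - 1 \<noteq> a" if "i < k - 1" "odd (k - 1 - i)" for i
    proof -
      have "odd i" "i < 2 * m" using that by (auto simp: k)
      then have "0 < i" by (auto intro: ccontr)
      then show ?thesis using \<open>odd i\<close> \<open>i < 2 * m\<close> p by (auto simp: d_def \<epsilon>_def minus_equation_iff)
    qed
    show "d i - \<epsilon> i \<noteq> 0 \<and> d i - \<epsilon> i \<noteq> a \<and> d i - \<epsilon> i \<noteq> d (Suc i) - 1"
      if "i < k - 1" "even (k - 1 - i)" for i
    proof -
      have "even i" "i < 2 * m" using that by (auto simp: k)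
      moreover from this have "Suc i \<noteq> 2 * m" by (metis even_Suc even_mult_iff even_numeral)
      ultimately show ?thesis using p pp by (auto simp: d_def \<epsilon>_def)
    qed
  qed
qed

section \<open>A linear operator and the polynomials in it\<close>

locale endomorphism = vector_space scale
  for scale :: "'f::field \<Rightarrow> 'b::ab_group_add \<Rightarrow> 'b" (infixr \<open>*s\<close> 75) +
  fixes T :: "'b \<Rightarrow> 'b"
  assumes linear_T: "Vector_Spaces.linear scale scale T"
begin

abbreviation lin :: "('b \<Rightarrow> 'b) \<Rightarrow> bool" where
  "lin \<equiv> Vector_Spaces.linear scale scale"

lemma linI:
  assumes "\<And>x y. f (x + y) = f x + f y" "\<And>c x. f (c *s x) = c *s f x"
  shows "lin f"
  using assms by (simp add: Vector_Spaces.linear_iff vector_space_axioms)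

lemma lin_add: "lin f \<Longrightarrow> f (x + y) = f x + f y"
  and lin_scale: "lin f \<Longrightarrow> f (c *s x) = c *s f x"
  by (simp_all add: Vector_Spaces.linear_iff)

lemma lin_compose: "lin f \<Longrightarrow> lin g \<Longrightarrow> lin (\<lambda>x. f (g x))"
  by (simp add: Vector_Spaces.linear_iff)

lemma lin_zero: "lin f \<Longrightarrow> f 0 = 0"
  using lin_scale[of f 0 0] by simp

lemma lin_diff: "lin f \<Longrightarrow> f (x - y) = f x - f y"
  using lin_add[of f "x - y" y] by simp

lemma lin_sum: "lin f \<Longrightarrow> f (\<Sum>i\<in>A. g i) = (\<Sum>i\<in>A. f (g i))"
  by (induction A rule: infinite_finite_induct) (simp_all add: lin_zero lin_add)

lemmas lin_rules = lin_add lin_scale lin_zero lin_diff lin_sum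

lemma lin_funpow: "lin f \<Longrightarrow> lin (f ^^ n)"
  by (induction n) (auto intro!: linI simp: lin_rules)

lemmas T_rules = lin_rules[OF linear_T]

lemma lin_eq_on_span:
  assumes "lin f" "lin g" "x \<in> span B" "\<And>b. b \<in> B \<Longrightarrow> f b = g b"
  shows "f x = g x"
  using assms(3)
proof (induction rule: span_induct_alt)
  case base
  then show ?case using assms by (simp add: lin_zero)
next
  case (step c b y)
  then show ?case using assms(1,2,4) by (simp add: lin_rules)
qed

lemma lin_maps_span:
  assumes "lin f" "x \<in> span B" "\<And>b. b \<in> B \<Longrightarrow> f b \<in> span C"
  shows "f x \<in> span C"
  using assms(2)
proof (induction rule: span_induct_alt)
  case base
  then show ?case using assms by (simp add: lin_zero span_zero)
next
  case (step c b y)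
  then show ?case using assms(1,3) by (simp add: lin_rules span_add span_scale)
qed

text \<open>The action of a polynomial on a vector when the indeterminate acts as \<open>T\<close>, evaluated by Horner's
scheme.\<close>

definition act :: "'f poly \<Rightarrow> 'b \<Rightarrow> 'b" where
  "act p x = fold_coeffs (\<lambda>a y. a *s x + T y) p 0"

lemma act_0 [simp]: "act 0 x = 0"
  by (simp add: act_def)

lemma act_pCons [simp]: "act (pCons a p) x = a *s x + T (act p x)"
  by (cases "a = 0 \<and> p = 0") (auto simp: act_def T_rules)

lemma act_1 [simp]: "act 1 x = x"
  by (simp add: one_pCons T_rules)

lemma act_add: "act (p + q) x = act p x + act q x"
  by (induction p q rule: poly_induct2) (simp_all add: T_rules algebra_simps)

lemma act_smult: "act (smult c p) x = c *s act p x"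
  by (induction p) (simp_all add: T_rules algebra_simps)

lemma act_diff: "act (p - q) x = act p x - act q x"
  using act_add[of "p - q" q x] by simp

lemma act_sum: "act (\<Sum>i\<in>A. p i) x = (\<Sum>i\<in>A. act (p i) x)"
  by (induction A rule: infinite_finite_induct) (simp_all add: act_add)

lemma act_mult: "act (p * q) x = act p (act q x)"
  by (induction p) (simp_all add: act_add act_smult)

lemma act_commute:
  assumes "lin f" "\<And>x. f (T x) = T (f x)"
  shows "f (act p x) = act p (f x)"
  by (induction p) (simp_all add: assms(2) lin_rules[OF assms(1)])

lemma lin_act: "lin (act p)"
proof (rule linI)
  show "act p (x + y) = act p x + act p y" for x y
    by (induction p) (simp_all add: T_rules algebra_simps)
  show "act p (c *s x) = c *s act p x" for c x
    by (rule act_commute[symmetric]) (auto intro: linI simp: algebra_simps T_rules)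
qed

lemmas act_rules = lin_rules[OF lin_act]

lemma act_power: "act (p ^ n) x = (act p ^^ n) x"
  by (induction n) (simp_all add: act_mult)

lemma act_monom: "act (monom c n) x = c *s (T ^^ n) x"
  by (induction n) (simp_all add: monom_0 monom_Suc T_rules)

section \<open>Indecomposable invariant summands\<close>

text \<open>A \<open>T\<close>-invariant direct summand is represented by the projection onto it along a \<open>T\<close>-invariant
complement. In this form a splitting on a summand consists of operators on the whole space, and
splittings on two complementary summands can simply be added.\<close>

definition summand :: "('b \<Rightarrow> 'b) \<Rightarrow> bool" where
  "summand P \<longleftrightarrow> lin P \<and> (\<forall>x. P (P x) = P x) \<and> (\<forall>x. P (T x) = T (P x))"

lemma summandD:
  assumes "summand P"
  shows "lin P" "P (P x) = P x" "P (T x) = T (P x)" "P (act p x) = act p (P x)"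
  using assms act_commute[of P] by (auto simp: summand_def)

definition indecomposable :: "('b \<Rightarrow> 'b) \<Rightarrow> bool" where
  "indecomposable P \<longleftrightarrow> summand P \<and> (\<exists>x. P x \<noteq> 0) \<and>
     (\<forall>Q. summand Q \<and> (\<forall>x. P (Q x) = Q x) \<and> (\<forall>x. Q (P x) = Q x) \<longrightarrow> (\<forall>x. Q x = 0) \<or> Q = P)"

text \<open>Some power of the polynomial is idempotent on the finite set \<open>range P\<close>, so it is the projection onto a
summand contained in \<open>range P\<close>. As \<open>P\<close> is indecomposable, this projection is \<open>0\<close> or \<open>P\<close>, and it is not \<open>P\<close>
because it kills \<open>x\<close>.\<close>

lemma nilpotent_if_singular:
  assumes P: "indecomposable P" and fin: "finite (range P)"
    and x: "P x = x" "x \<noteq> 0" "act g x = 0"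
  shows "\<exists>n. \<forall>y. act (g ^ n) (P y) = 0"
proof -
  have S: "summand P" using P by (simp add: indecomposable_def)
  note PD = summandD[OF S]
  have "act g y \<in> range P" if "y \<in> range P" for y
    using that PD(4) by (metis imageE rangeI)
  from iterates_idempotent[of "range P" "act g", OF fin this]
  obtain n where n: "\<And>y. (act g ^^ n) ((act g ^^ n) (P y)) = (act g ^^ n) (P y)" and "0 < n"
    by auto
  define Q where "Q = (\<lambda>y. act (g ^ n) (P y))"
  have "summand Q"
    unfolding summand_def
  proof (intro conjI allI)
    show "lin Q" by (rule linI) (simp_all add: Q_def act_rules lin_rules[OF PD(1)])
    show "Q (Q y) = Q y" for y
      by (simp add: Q_def PD(4) PD(2)) (simp add: act_power n)
    show "Q (T y) = T (Q y)" for y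
      by (simp add: Q_def PD(3) act_commute[OF linear_T])
  qed
  moreover have "P (Q y) = Q y" "Q (P y) = Q y" for y
    by (simp_all add: Q_def PD)
  ultimately have "(\<forall>y. Q y = 0) \<or> Q = P"
    using P by (auto simp: indecomposable_def)
  moreover have "Q x = 0"
  proof -
    obtain n' where "n = Suc n'" using \<open>0 < n\<close> gr0_implies_Suc by blast
    then show ?thesis using x by (simp add: Q_def power_Suc2 act_mult act_rules del: power_Suc)
  qed
  ultimately have "\<forall>y. Q y = 0" using x by auto
  then show ?thesis by (auto simp: Q_def)
qed

text \<open>As \<open>h\<close> is nilpotent on the summand, the last nonzero vector among \<open>x, h x, h\<^sup>2 x, ...\<close> is killed by \<open>h\<close>, and
it is still killed by \<open>g\<close>.\<close>

lemma singular_common: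
  assumes P: "indecomposable P" and fin: "finite (range P)"
    and g: "P x = x" "x \<noteq> 0" "act g x = 0" and h: "P y = y" "y \<noteq> 0" "act h y = 0"
  shows "\<exists>z. P z = z \<and> z \<noteq> 0 \<and> act g z = 0 \<and> act h z = 0"
proof -
  obtain n where n: "act (h ^ n) x = 0"
    using nilpotent_if_singular[OF P fin h] g(1) by metis
  define m where "m = (LEAST n. act (h ^ n) x = 0)"
  have m: "act (h ^ m) x = 0" unfolding m_def using n by (rule LeastI)
  then obtain m' where m': "m = Suc m'" using g(2) by (cases m) auto
  let ?z = "act (h ^ m') x"
  have "?z \<noteq> 0" using not_less_Least[of m' "\<lambda>n. act (h ^ n) x = 0"] m' by (auto simp: m_def)
  moreover have "act h ?z = 0" using m by (simp add: m' act_mult)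
  moreover have "act g ?z = 0"
    using g(3) by (metis act_mult act_rules(3) mult.commute)
  moreover have "P ?z = ?z"
    using P g(1) summandD(4) by (metis indecomposable_def)
  ultimately show ?thesis by blast
qed

text \<open>The polynomials that are singular on an indecomposable summand are the multiples of one polynomial
\<open>\<pi>\<close>, and \<open>\<pi>\<^sup>m\<close> is zero on the summand for some least \<open>m\<close>. A vector \<open>v\<close> not killed by \<open>\<pi>\<^sup>m\<^sup>-\<^sup>1\<close> is then killed by
no nonzero polynomial of degree below \<open>k = deg \<pi>\<^sup>m\<close>, while \<open>\<pi>\<^sup>m\<close> expresses \<open>T\<^sup>k\<close> by lower powers of \<open>T\<close> on the whole
summand.\<close>

lemma indecomposable_cyclic:
  assumes P: "indecomposable P" and fin: "finite (range P)"
  obtains k v c where "0 < k" "P v = v"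
    "\<And>g. g \<noteq> 0 \<Longrightarrow> degree g < k \<Longrightarrow> act g v \<noteq> 0"
    "\<And>x. (T ^^ k) (P x) = (\<Sum>i<k. c i *s (T ^^ i) (P x))"
proof -
  have S: "summand P" and ne: "\<exists>x. P x \<noteq> 0" using P by (auto simp: indecomposable_def)
  note PD = summandD[OF S]
  define sing where "sing g \<longleftrightarrow> (\<exists>x. P x = x \<and> x \<noteq> 0 \<and> act g x = 0)" for g
  have nil: "\<exists>n. \<forall>y. act (g ^ n) (P y) = 0" if "sing g" for g
    using that nilpotent_if_singular[OF P fin] unfolding sing_def by blast
  have "\<exists>g. g \<noteq> 0 \<and> sing g"
  proof -
    have "T y \<in> range P" if "y \<in> range P" for y
      using that PD(3) by (metis imageE rangeI)
    from iterates_repeat[of "range P" T, OF fin this]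
    obtain i j where ij: "i < j" "\<And>y. (T ^^ i) (P y) = (T ^^ j) (P y)" by auto
    let ?g = "monom 1 j - monom 1 i :: 'f poly"
    have "coeff ?g j = 1" using ij by simp
    then have "?g \<noteq> 0" by (metis coeff_0 zero_neq_one)
    moreover have "sing ?g"
    proof -
      obtain x where "P x \<noteq> 0" using ne by blast
      moreover have "act ?g (P x) = 0" by (simp add: act_diff act_monom ij(2))
      ultimately show ?thesis using PD(2)[of x] unfolding sing_def by blast
    qed
    ultimately show ?thesis by blast
  qed
  then obtain g0 where g0: "g0 \<noteq> 0 \<and> sing g0" by blast
  obtain \<pi> where pi: "\<pi> \<noteq> 0" "sing \<pi>"
    and least: "\<And>g. g \<noteq> 0 \<Longrightarrow> sing g \<Longrightarrow> degree \<pi> \<le> degree g"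
    using ex_has_least_nat[of "\<lambda>g. g \<noteq> 0 \<and> sing g" g0 degree, OF g0] by blast
  have dvd: "\<pi> dvd g" if sing_g: "sing g" for g
  proof -
    obtain z where z: "P z = z" "z \<noteq> 0" "act g z = 0" "act \<pi> z = 0"
      using sing_g pi(2) singular_common[OF P fin, of _ g _ \<pi>] unfolding sing_def by blast
    \<comment> \<open>The remainder kills \<open>z\<close> too, so it is singular of smaller degree and must vanish.\<close>
    have "act (g mod \<pi>) z = act (g - (g div \<pi>) * \<pi>) z" by (simp add: minus_div_mult_eq_mod)
    also have "\<dots> = 0" using z by (simp add: act_diff act_mult act_rules)
    finally have "sing (g mod \<pi>)" using z sing_def by blast
    then have "g mod \<pi> = 0" using least[of "g mod \<pi>"] degree_mod_less[of \<pi> g] pi(1) by force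
    then show ?thesis by (simp add: dvd_eq_mod_eq_0)
  qed
  have deg_pi: "0 < degree \<pi>"
  proof (rule ccontr)
    assume "\<not> 0 < degree \<pi>"
    then obtain c where c: "\<pi> = [:c:]" "c \<noteq> 0" using pi(1) by (metis degree_eq_zeroE gr0I pCons_eq_0_iff)
    then show False using pi(2) by (auto simp: sing_def T_rules)
  qed
  define m where "m = (LEAST n. \<forall>y. act (\<pi> ^ n) (P y) = 0)"
  have m: "act (\<pi> ^ m) (P y) = 0" for y
    using LeastI_ex[OF nil[OF pi(2)]] by (simp add: m_def)
  obtain m' where m': "m = Suc m'" using m ne by (cases m) auto
  obtain y0 where "act (\<pi> ^ m') (P y0) \<noteq> 0"
    using not_less_Least[of m' "\<lambda>n. \<forall>y. act (\<pi> ^ n) (P y) = 0"] m' by (auto simp: m_def)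
  define v where "v = P y0"
  have v: "P v = v" "act (\<pi> ^ m') v \<noteq> 0"
    using \<open>act (\<pi> ^ m') (P y0) \<noteq> 0\<close> by (simp_all add: v_def PD)
  define k where "k = degree (\<pi> ^ m)"
  have k: "k = m * degree \<pi>" using pi(1) by (simp add: k_def degree_power_eq)
  show thesis
  proof (rule that)
    show "0 < k" using deg_pi by (simp add: k m')
    show "P v = v" by (rule v)
    show "act g v \<noteq> 0" if g: "g \<noteq> 0" "degree g < k" for g
    proof
      assume g0: "act g v = 0"
      \<comment> \<open>Extract all factors \<open>\<pi>\<close>; the cofactor \<open>s\<close> is injective on the summand.\<close>
      have "\<exists>j s. g = \<pi> ^ j * s \<and> \<not> \<pi> dvd s"
        using g(1)
      proof (induction "degree g" arbitrary: g rule: less_induct)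
        case less
        show ?case
        proof (cases "\<pi> dvd g")
          case True
          then obtain h where h: "g = \<pi> * h" by blast
          then have "h \<noteq> 0" "degree h < degree g" using less.prems deg_pi pi(1) by (auto simp: degree_mult_eq)
          from less.hyps[OF this(2) this(1)] obtain j s where "h = \<pi> ^ j * s" "\<not> \<pi> dvd s" by blast
          then have "g = \<pi> ^ Suc j * s" using h by (simp add: mult.assoc)
          then show ?thesis using \<open>\<not> \<pi> dvd s\<close> by blast
        next
          case False
          then show ?thesis by (intro exI[of _ 0] exI[of _ g]) simp
        qed
      qed
      then obtain j s where js: "g = \<pi> ^ j * s" "\<not> \<pi> dvd s" by blast
      then have "s \<noteq> 0" using g(1) by auto
      then have "j * degree \<pi> \<le> degree g" using js(1) pi(1) by (simp add: degree_mult_eq degree_power_eq)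
      then have "j * degree \<pi> < m * degree \<pi>" using g(2) k by linarith
      then have "j \<le> m'" unfolding m' by (metis mult_less_cancel2 less_Suc_eq_le)
      have "P (act (\<pi> ^ j) v) = act (\<pi> ^ j) v" by (simp add: PD v)
      moreover have "act s (act (\<pi> ^ j) v) = 0" using g0 js(1) by (metis act_mult mult.commute)
      ultimately have "act (\<pi> ^ j) v = 0" using js(2) dvd unfolding sing_def by blast
      then have "act (\<pi> ^ (m' - j) * \<pi> ^ j) v = 0" by (simp add: act_mult act_rules)
      then show False using v(2) \<open>j \<le> m'\<close> by (simp add: power_add[symmetric])
    qed
    define p where "p = \<pi> ^ m"
    let ?c = "\<lambda>i. - coeff p i / coeff p k"
    show "(T ^^ k) (P x) = (\<Sum>i<k. ?c i *s (T ^^ i) (P x))" for x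
    proof -
      have lc: "coeff p k \<noteq> 0" using pi(1) by (simp add: k_def p_def)
      have "p = (\<Sum>i\<le>k. monom (coeff p i) i)" by (metis k_def p_def poly_as_sum_of_monoms)
      then have "act p (P x) = (\<Sum>i\<le>k. coeff p i *s (T ^^ i) (P x))"
        by (metis (no_types, lifting) act_monom act_sum sum.cong)
      then have "0 = coeff p k *s (T ^^ k) (P x) + (\<Sum>i<k. coeff p i *s (T ^^ i) (P x))"
        using m[of x] by (simp add: p_def lessThan_Suc_atMost[symmetric] add.commute)
      then have "coeff p k *s (T ^^ k) (P x) = - (\<Sum>i<k. coeff p i *s (T ^^ i) (P x))"
        by (simp add: eq_neg_iff_add_eq_0)
      then have "(1 / coeff p k) *s coeff p k *s (T ^^ k) (P x)
          = (1 / coeff p k) *s (\<Sum>i<k. (- coeff p i) *s (T ^^ i) (P x))"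
        by (simp add: sum_negf)
      then show ?thesis using lc by (simp add: scale_sum_right)
    qed
  qed
qed

text \<open>The subspace generated by \<open>v\<close> has an invariant complement. Let \<open>\<phi>\<close> be a functional that on this
subspace reads off the coefficient of \<open>T\<^sup>k\<^sup>-\<^sup>1 v\<close>. The coefficient of \<open>T\<^sup>k\<^sup>-\<^sup>1\<^sup>-\<^sup>j v\<close> is read off by \<open>\<chi> j\<close>, the composition of \<open>\<phi>\<close> with the
\<open>j\<close>-th Horner polynomial of the relation \<open>T\<^sup>k = \<Sum> c i T\<^sup>i\<close>. These functionals are defined on the whole
space, and because the relation holds on all of \<open>range P\<close>, the projection that they define commutes
with \<open>T\<close>.\<close>

lemma cyclic_split_projection:
  assumes S: "summand P" and "0 < k" and v: "P v = v"
    and free: "\<And>g. g \<noteq> 0 \<Longrightarrow> degree g < k \<Longrightarrow> act g v \<noteq> 0"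
    and rec: "\<And>x. (T ^^ k) (P x) = (\<Sum>i<k. c i *s (T ^^ i) (P x))"
  obtains Q where "summand Q" "\<And>x. P (Q x) = Q x" "\<And>x. Q (P x) = Q x" "Q v = v"
    "\<And>x. Q x \<in> span ((\<lambda>i. (T ^^ i) v) ` {..<k})"
proof -
  note PD = summandD[OF S]
  have indep: "\<forall>i<k. u i = 0" if "(\<Sum>i<k. u i *s (T ^^ i) v) = 0" for u
  proof -
    let ?g = "\<Sum>i<k. monom (u i) i"
    have "act ?g v = 0" using that by (simp add: act_sum act_monom)
    moreover have "degree ?g < k"
      using \<open>0 < k\<close> by (intro degree_lessI) (auto simp: coeff_sum sum.delta intro!: sum.neutral)
    ultimately have "?g = 0" using free by blast
    moreover have "coeff ?g i = (if i < k then u i else 0)" for i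
      by (simp add: coeff_sum sum.delta)
    ultimately show ?thesis by (metis coeff_0)
  qed
  obtain \<phi> where \<phi>: "Vector_Spaces.linear scale (*) \<phi>"
    and \<phi>_v: "\<And>i. i < k \<Longrightarrow> \<phi> ((T ^^ i) v) = (if i = k - 1 then 1 else 0 :: 'f)"
    using functional_extend_family[where k = k and b = "\<lambda>i. (T ^^ i) v" and
      y = "\<lambda>i. if i = k - 1 then 1 else 0", OF indep]
    by blast
  have \<phi>_add: "\<phi> (x + y) = \<phi> x + \<phi> y" and \<phi>_scale: "\<phi> (a *s x) = a * \<phi> x" for x y a
    using \<phi> by (simp_all add: Vector_Spaces.linear_iff)
  have \<phi>_sum: "\<phi> (\<Sum>i\<in>A. g i) = (\<Sum>i\<in>A. \<phi> (g i))" for A :: "nat set" and g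
    using \<phi>_scale[of 0 0] by (induction A rule: infinite_finite_induct) (simp_all add: \<phi>_add)
  define \<chi> where "\<chi> j x = \<phi> ((T ^^ j) x) - (\<Sum>l<j. c (k - Suc l) * \<phi> ((T ^^ (j - Suc l)) x))" for j x
  have \<chi>_add: "\<chi> j (x + y) = \<chi> j x + \<chi> j y" for j x y
    by (simp add: \<chi>_def lin_rules[OF lin_funpow[OF linear_T]] \<phi>_add algebra_simps sum.distrib)
  have \<chi>_scale: "\<chi> j (a *s x) = a * \<chi> j x" for j a x
    by (simp add: \<chi>_def lin_rules[OF lin_funpow[OF linear_T]] \<phi>_scale right_diff_distrib sum_distrib_left
        mult.left_commute)
  have \<chi>_0: "\<chi> 0 x = \<phi> x" for x by (simp add: \<chi>_def)
  have \<chi>_T: "\<chi> j (T x) = \<chi> (Suc j) x + c (k - Suc j) * \<phi> x" for j x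
  proof -
    have "(\<Sum>l<j. c (k - Suc l) * \<phi> ((T ^^ (j - Suc l)) (T x)))
        = (\<Sum>l<j. c (k - Suc l) * \<phi> ((T ^^ (Suc j - Suc l)) x))"
      by (rule sum.cong) (simp_all add: funpow_swap1 Suc_diff_Suc[symmetric] del: Suc_diff_Suc)
    then show ?thesis by (simp add: \<chi>_def funpow_swap1)
  qed
  have \<chi>_k: "\<chi> k (P x) = 0" for x
  proof -
    have "(\<Sum>l<k. c (k - Suc l) * \<phi> ((T ^^ (k - Suc l)) (P x))) = (\<Sum>i<k. c i * \<phi> ((T ^^ i) (P x)))"
      by (rule sum.nat_diff_reindex)
    then show ?thesis by (simp add: \<chi>_def rec \<phi>_sum \<phi>_scale)
  qed
  have \<chi>_v: "\<chi> j v = (if j = k - 1 then 1 else 0)" if "j < k" for j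
  proof -
    have "(\<Sum>l<j. c (k - Suc l) * \<phi> ((T ^^ (j - Suc l)) v)) = 0"
      by (rule sum.neutral) (use that in \<open>auto simp: \<phi>_v\<close>)
    then show ?thesis using that by (simp add: \<chi>_def \<phi>_v)
  qed
  define Q where "Q x = (\<Sum>j<k. \<chi> j (P x) *s (T ^^ (k - Suc j)) v)" for x
  have lin_Q: "lin Q"
    by (rule linI)
      (simp_all add: Q_def lin_rules[OF PD(1)] \<chi>_add \<chi>_scale sum.distrib scale_left_distrib scale_sum_right)
  have QT: "Q (T x) = T (Q x)" for x
  proof -
    obtain k' where k': "k = Suc k'" using \<open>0 < k\<close> gr0_implies_Suc by blast
    let ?y = "P x"
    have "Q (T x) = (\<Sum>j<k. \<chi> (Suc j) ?y *s (T ^^ (k - Suc j)) v)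
        + (\<Sum>j<k. (c (k - Suc j) * \<phi> ?y) *s (T ^^ (k - Suc j)) v)"
      by (simp add: Q_def PD(3) \<chi>_T scale_left_distrib sum.distrib)
    also have "(\<Sum>j<k. (c (k - Suc j) * \<phi> ?y) *s (T ^^ (k - Suc j)) v) = \<phi> ?y *s (T ^^ k) v"
      using sum.nat_diff_reindex[of "\<lambda>i. (c i * \<phi> ?y) *s (T ^^ i) v" k] rec[of v]
      by (simp add: v scale_sum_right mult.commute)
    also have "(\<Sum>j<k. \<chi> (Suc j) ?y *s (T ^^ (k - Suc j)) v)
        = (\<Sum>j<k'. \<chi> (Suc j) ?y *s (T ^^ (k - Suc j)) v)"
      using \<chi>_k[of x] by (simp add: k')
    also have "\<dots> + \<phi> ?y *s (T ^^ k) v = (\<Sum>j<k. \<chi> j ?y *s (T ^^ (k - j)) v)"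
      by (simp only: k' sum.lessThan_Suc_shift) (simp add: \<chi>_0 del: funpow.simps)
    also have "\<dots> = (\<Sum>j<k. \<chi> j ?y *s T ((T ^^ (k - Suc j)) v))"
      by (rule sum.cong) (auto simp: Suc_diff_Suc[symmetric] simp del: Suc_diff_Suc)
    also have "\<dots> = T (Q x)" by (simp add: Q_def T_rules)
    finally show ?thesis .
  qed
  have Qv: "Q v = v"
  proof -
    have "Q v = (\<Sum>j<k. if j = k - 1 then (T ^^ (k - Suc j)) v else 0)"
      unfolding Q_def v by (rule sum.cong) (auto simp: \<chi>_v)
    also have "\<dots> = v" using \<open>0 < k\<close> by (subst sum.delta) auto
    finally show ?thesis .
  qed
  have QTi: "Q ((T ^^ i) v) = (T ^^ i) v" for i
    by (induction i) (simp_all add: Qv QT)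
  have PTi: "P ((T ^^ i) v) = (T ^^ i) v" for i
    by (induction i) (simp_all add: v PD(3))
  have QQ: "Q (Q x) = Q x" for x
    by (subst (2 3) Q_def) (simp add: lin_rules[OF lin_Q] QTi)
  show thesis
  proof (rule that)
    show "summand Q" using lin_Q QQ QT by (simp add: summand_def)
    show "P (Q x) = Q x" for x by (simp add: Q_def lin_rules[OF PD(1)] PTi)
    show "Q (P x) = Q x" for x by (simp add: Q_def PD)
    show "Q v = v" by (rule Qv)
    show "Q x \<in> span ((\<lambda>i. (T ^^ i) v) ` {..<k})" for x
      unfolding Q_def using \<open>0 < k\<close> by (intro span_sum span_scale span_base) auto
  qed
qed

section \<open>Splitting an operator on a summand\<close>

definition splits :: "nat \<Rightarrow> ('b \<Rightarrow> 'b) \<Rightarrow> bool" where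
  "splits N P \<longleftrightarrow> (\<exists>E V. lin E \<and> lin V \<and>
     (\<forall>x. E (E x) = E x \<and> P (E x) = E x \<and> E (P x) = E x \<and>
          P (V x) = V x \<and> V (P x) = V x \<and> (V ^^ N) (P x) = P x \<and> T (P x) = E x + V x))"

text \<open>The basis \<open>w i = (T - d 0) \<cdots> (T - d (i - 1)) v\<close>. The vector \<open>w k\<close> lies in the span of \<open>w 0, ..., w (k - 1)\<close>, and its
coefficient at \<open>w (k - 1)\<close> is \<open>c (k - 1) - \<Sum> d i\<close>, which vanishes by the assumption on the trace.\<close>

lemma hessenberg_basis:
  fixes d :: "nat \<Rightarrow> 'f"
  assumes S: "summand P" and "0 < k" and v: "P v = v"
    and free: "\<And>g. g \<noteq> 0 \<Longrightarrow> degree g < k \<Longrightarrow> act g v \<noteq> 0"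
    and rec: "\<And>x. (T ^^ k) (P x) = (\<Sum>i<k. c i *s (T ^^ i) (P x))"
    and spans: "\<And>x. P x \<in> span ((\<lambda>i. (T ^^ i) v) ` {..<k})"
    and tr: "(\<Sum>i<k. d i) = c (k - 1)"
  obtains w where "\<And>i. P (w i) = w i" "\<And>i. T (w i) = w (Suc i) + d i *s w i"
    "\<And>u. (\<Sum>i<k. u i *s w i) = 0 \<Longrightarrow> \<forall>i<k. u i = 0"
    "\<And>x. P x \<in> span (w ` {..<k})"
    "w k \<in> span (w ` {..<k - 1})"
proof -
  note PD = summandD[OF S]
  define h where "h i = (\<Prod>j<i. [:- d j, 1:])" for i
  define w where "w i = act (h i) v" for i
  have deg_h: "degree (h i) = i" "h i \<noteq> 0" for i
  proof -
    show "h i \<noteq> 0" by (simp add: h_def)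
    show "degree (h i) = i" by (simp add: h_def degree_prod_eq_sum_degree)
  qed
  have Tw: "T (w i) = w (Suc i) + d i *s w i" for i
    by (simp add: w_def h_def mult.commute[of "prod _ _"] act_diff act_smult)
  have w0: "w 0 = v" by (simp add: w_def h_def)
  have Pw: "P (w i) = w i" for i by (simp add: w_def PD v)
  let ?W = "\<lambda>j. span (w ` {..<j})"
  have W_mono: "x \<in> ?W j" if "x \<in> ?W i" "i \<le> j" for x i j
    using that span_mono[of "w ` {..<i}" "w ` {..<j}"] by (auto simp: image_mono)
  have wW: "w i \<in> ?W j" if "i < j" for i j using that by (auto intro: span_base)
  have TW: "T x \<in> ?W (Suc j)" if "x \<in> ?W j" for x j
    by (rule lin_maps_span[OF linear_T that]) (auto simp: Tw intro!: span_add span_scale wW)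
  define \<sigma> where "\<sigma> n = (\<Sum>i<n. d i)" for n
  \<comment> \<open>The two leading terms of \<open>T ^^ Suc j\<close> applied to \<open>v\<close> in terms of the new basis.\<close>
  have power_w: "(T ^^ Suc j) v - w (Suc j) - \<sigma> (Suc j) *s w j \<in> ?W j" for j
  proof (induction j)
    case 0
    have "T v = w 1 + d 0 *s v" using Tw[of 0] by (simp add: w0)
    then show ?case by (simp add: \<sigma>_def w0 span_zero)
  next
    case (Suc j)
    define z where "z = (T ^^ Suc j) v - w (Suc j) - \<sigma> (Suc j) *s w j"
    have z: "T z \<in> ?W (Suc j)" using TW Suc z_def by blast
    have "(T ^^ Suc j) v = z + w (Suc j) + \<sigma> (Suc j) *s w j" by (simp add: z_def)
    then have "(T ^^ Suc (Suc j)) v = T (z + w (Suc j) + \<sigma> (Suc j) *s w j)" by simp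
    also have "\<dots> = T z + T (w (Suc j)) + \<sigma> (Suc j) *s T (w j)" by (simp add: T_rules)
    also have "\<dots> - w (Suc (Suc j)) - \<sigma> (Suc (Suc j)) *s w (Suc j) = T z + (\<sigma> (Suc j) * d j) *s w j"
      by (simp add: Tw \<sigma>_def algebra_simps)
    finally show ?case using z wW[of j "Suc j"] by (simp add: span_add span_scale)
  qed
  have power_w': "(T ^^ j) v - w j \<in> ?W j" for j
  proof (cases j)
    case 0
    then show ?thesis by (simp add: w0 span_zero)
  next
    case (Suc i)
    have "(T ^^ Suc i) v - w (Suc i) = ((T ^^ Suc i) v - w (Suc i) - \<sigma> (Suc i) *s w i) + \<sigma> (Suc i) *s w i"
      by simp
    then show ?thesis unfolding Suc
      using power_w[of i] wW[of i "Suc i"] W_mono[of _ i "Suc i"] by (metis lessI less_imp_le span_add span_scale)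
  qed
  have power_W: "(T ^^ i) v \<in> ?W j" if "i < j" for i j
  proof -
    have "(T ^^ i) v = ((T ^^ i) v - w i) + w i" by simp
    then show ?thesis
      using W_mono[OF power_w'[of i], of j] wW[OF that] that by (metis less_imp_le span_add)
  qed
  obtain k' where k': "k = Suc k'" using \<open>0 < k\<close> gr0_implies_Suc by blast
  show thesis
  proof (rule that)
    show "P (w i) = w i" "T (w i) = w (Suc i) + d i *s w i" for i by (rule Pw Tw)+
    show "\<forall>i<k. u i = 0" if u: "(\<Sum>i<k. u i *s w i) = 0" for u
    proof (rule ccontr)
      assume "\<not> (\<forall>i<k. u i = 0)"
      then have ex: "{i. i < k \<and> u i \<noteq> 0} \<noteq> {}" by auto
      \<comment> \<open>The leading term of the combination cannot cancel, since \<open>h i\<close> has degree \<open>i\<close>.\<close>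
      define M where "M = Max {i. i < k \<and> u i \<noteq> 0}"
      have M: "M < k" "u M \<noteq> 0" using Max_in[OF _ ex] by (auto simp: M_def)
      have above: "u i = 0" if "M < i" "i < k" for i
      proof (rule ccontr)
        assume "u i \<noteq> 0"
        then have "i \<le> M" unfolding M_def using that by (intro Max_ge) auto
        then show False using that by simp
      qed
      let ?g = "\<Sum>i<k. smult (u i) (h i)"
      have "act ?g v = 0" using u by (simp add: act_sum act_smult w_def)
      moreover have "coeff ?g M = u M * lead_coeff (h M)"
      proof -
        have "coeff ?g M = (\<Sum>i<k. if i = M then u M * lead_coeff (h M) else 0)"
          unfolding coeff_sum
        proof (rule sum.cong)
          fix i assume "i \<in> {..<k}"
          then show "coeff (smult (u i) (h i)) M = (if i = M then u M * lead_coeff (h M) else 0)"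
            using above[of i] deg_h(1) coeff_eq_0[of "h i" M] by (cases i M rule: linorder_cases) auto
        qed simp
        then show ?thesis using M by (simp add: sum.delta)
      qed
      then have "?g \<noteq> 0" using M deg_h by (metis coeff_0 leading_coeff_0_iff mult_eq_0_iff)
      moreover have "degree ?g < k"
        using \<open>0 < k\<close> deg_h(1)
        by (intro degree_lessI) (auto simp: coeff_sum coeff_eq_0 intro!: sum.neutral)
      ultimately show False using free by blast
    qed
    show "P x \<in> ?W k" for x
    proof -
      have "span ((\<lambda>i. (T ^^ i) v) ` {..<k}) \<subseteq> ?W k"
        by (rule span_minimal) (auto intro: power_W)
      then show ?thesis using spans by blast
    qed
    have "(T ^^ Suc k') v = (\<Sum>i<k'. c i *s (T ^^ i) v) + c k' *s (T ^^ k') v"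
      using rec[of v] by (simp add: v k' del: funpow.simps)
    also have "c k' = \<sigma> (Suc k')" using tr by (simp add: k' \<sigma>_def)
    finally have "w (Suc k') = (\<Sum>i<k'. c i *s (T ^^ i) v) + \<sigma> (Suc k') *s ((T ^^ k') v - w k')
        - ((T ^^ Suc k') v - w (Suc k') - \<sigma> (Suc k') *s w k')"
      by (simp add: algebra_simps del: funpow.simps)
    also have "\<dots> \<in> ?W k'"
      by (intro span_diff span_add span_sum span_scale power_w power_w' power_W) auto
    finally show "w k \<in> ?W (k - 1)" by (simp add: k')
  qed
qed

text \<open>The idempotent \<open>E\<close> takes every second subdiagonal entry, counted from the last one upwards. At the
start \<open>w i\<close> of a pair, \<open>V = T - E\<close> has the eigenvector \<open>w i\<close> itself. At an inner end of a pair the block of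
\<open>w i\<close> and \<open>w (Suc i)\<close> is triangular with two different eigenvalues. Finally \<open>V\<close> maps the last basis vector
to \<open>a\<close> times itself plus a vector in the span of eigenvectors with eigenvalues other than \<open>a\<close>, where
\<open>V - a\<close> is invertible; so it can be corrected to an eigenvector for \<open>a\<close>.\<close>

lemma cyclic_splits:
  assumes two: "(2 :: 'f) \<noteq> 0" and big: "\<And>x y z :: 'f. \<exists>a. a \<notin> {x, y, z}"
    and N: "\<And>x :: 'f. x \<noteq> 0 \<Longrightarrow> x ^ N = 1"
    and S: "summand P" and "0 < k" and v: "P v = v"
    and free: "\<And>g. g \<noteq> 0 \<Longrightarrow> degree g < k \<Longrightarrow> act g v \<noteq> 0"
    and rec: "\<And>x. (T ^^ k) (P x) = (\<Sum>i<k. c i *s (T ^^ i) (P x))"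
    and spans: "\<And>x. P x \<in> span ((\<lambda>i. (T ^^ i) v) ` {..<k})"
  shows "splits N P"
proof -
  note PD = summandD[OF S]
  obtain d a \<epsilon> where tr: "(\<Sum>i<k. d i) = c (k - 1)" and a: "a \<noteq> 0" "a = d (k - 1) - \<epsilon> (k - 1)"
    and \<epsilon>: "\<And>i. \<epsilon> i * \<epsilon> i = \<epsilon> i" "\<And>i. 0 < i \<Longrightarrow> \<epsilon> i = 0"
    and head: "\<And>i. i < k - 1 \<Longrightarrow> odd (k - 1 - i) \<Longrightarrow> d i - 1 \<noteq> 0 \<and> d i - 1 \<noteq> a"
    and tail: "\<And>i. i < k - 1 \<Longrightarrow> even (k - 1 - i) \<Longrightarrow>
       d i - \<epsilon> i \<noteq> 0 \<and> d i - \<epsilon> i \<noteq> a \<and> d i - \<epsilon> i \<noteq> d (Suc i) - 1"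
    using hessenberg_diagonal[OF two big \<open>0 < k\<close>, of "c (k - 1)"] by blast
  obtain w where Pw: "\<And>i. P (w i) = w i" and Tw: "\<And>i. T (w i) = w (Suc i) + d i *s w i"
    and indep: "\<And>u. (\<Sum>i<k. u i *s w i) = 0 \<Longrightarrow> \<forall>i<k. u i = 0"
    and span_w: "\<And>x. P x \<in> span (w ` {..<k})"
    and wk: "w k \<in> span (w ` {..<k - 1})"
    using hessenberg_basis[OF S \<open>0 < k\<close> v free rec spans tr] by blast
  have basis_eq: "f (P x) = g (P x)" if "lin f" "lin g" "\<And>i. i < k \<Longrightarrow> f (w i) = g (w i)" for f g x
    using lin_eq_on_span[OF that(1,2) span_w] that(3) by auto
  have "vector_space_pair scale scale" by unfold_locales
  from vector_space_pair.linear_extend_family[OF this, where k = k and b = w and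
      y = "\<lambda>i. if odd (k - 1 - i) then w i + w (Suc i) else \<epsilon> i *s w i", OF indep]
  obtain E0 where lin_E0: "lin E0"
    and E0: "\<And>i. i < k \<Longrightarrow> E0 (w i) = (if odd (k - 1 - i) then w i + w (Suc i) else \<epsilon> i *s w i)"
    by blast
  define E where "E x = E0 (P x)" for x
  define V where "V x = T (P x) - E x" for x
  have lin_E: "lin E" unfolding E_def using lin_compose[OF lin_E0 PD(1)] .
  have lin_V: "lin V"
    by (rule linI) (simp_all add: V_def T_rules lin_rules[OF lin_E] lin_rules[OF PD(1)] algebra_simps)
  have Ew: "E (w i) = (if odd (k - 1 - i) then w i + w (Suc i) else \<epsilon> i *s w i)" if "i < k" for i
    using E0[OF that] by (simp add: E_def Pw)
  have PE: "P (E x) = E x" for x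
    unfolding E_def
    by (rule basis_eq[of "\<lambda>x. P (E0 x)" E0]) (auto intro: lin_compose lin_E0 PD(1) simp: E0 lin_rules[OF PD(1)] Pw)
  have EE: "E (E x) = E x" for x
  proof -
    have "E (E0 (P x)) = E0 (P x)"
    proof (rule basis_eq[of "\<lambda>x. E (E0 x)" E0])
      fix i assume i: "i < k"
      show "E (E0 (w i)) = E0 (w i)"
      proof (cases "odd (k - 1 - i)")
        case True
        then have "Suc i < k" using i by (metis Suc_lessI diff_Suc_1 diff_self_eq_0 even_zero)
        moreover from this True have "even (k - 1 - Suc i)" by (simp add: Suc_diff_Suc)
        ultimately show ?thesis using i True by (simp add: E0 lin_rules[OF lin_E] Ew \<epsilon>(2))
      next
        case False
        then show ?thesis using i by (simp add: E0 lin_rules[OF lin_E] Ew \<epsilon>(1))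
      qed
    qed (auto intro: lin_compose lin_E lin_E0)
    then show ?thesis by (simp add: E_def)
  qed
  define D where "D = {x. \<exists>b. b \<noteq> 0 \<and> b \<noteq> a \<and> V x = b *s x}"
  have Vw: "V (w i) = w (Suc i) + d i *s w i - E (w i)" for i by (simp add: V_def Pw Tw)
  have head_D: "w i \<in> D" if "i < k - 1" "odd (k - 1 - i)" for i
  proof -
    have "V (w i) = (d i - 1) *s w i" using that by (simp add: Vw Ew algebra_simps)
    then show ?thesis using head[OF that] D_def by blast
  qed
  have wD: "w i \<in> span D" if i: "i < k - 1" for i
  proof (cases "odd (k - 1 - i)")
    case True
    then show ?thesis using head_D[OF i] by (simp add: span_base)
  next
    case False
    have "Suc i < k - 1" using i False by (metis Suc_lessI diff_Suc_Suc diff_self_eq_0 even_Suc even_zero Suc_diff_Suc)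
    moreover from this False have "odd (k - 1 - Suc i)" by (metis Suc_diff_Suc even_Suc i)
    ultimately have next_D: "w (Suc i) \<in> D" and Vnext: "V (w (Suc i)) = (d (Suc i) - 1) *s w (Suc i)"
      using head_D by (auto simp: Vw Ew algebra_simps)
    define b where "b = d i - \<epsilon> i"
    define \<mu> where "\<mu> = d (Suc i) - 1"
    have b: "b \<noteq> 0" "b \<noteq> a" "b - \<mu> \<noteq> 0" using tail[OF i] False by (auto simp: b_def \<mu>_def)
    \<comment> \<open>The eigenvector for \<open>b\<close> in the triangular block with eigenvalues \<open>b\<close> and \<open>\<mu>\<close>.\<close>
    define y where "y = w i + (1 / (b - \<mu>)) *s w (Suc i)"
    have "1 + 1 / (b - \<mu>) * \<mu> = b * (1 / (b - \<mu>))" using b(3) by (simp add: field_simps)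
    moreover have "V (w i) = b *s w i + w (Suc i)"
      using i False by (simp add: Vw Ew b_def algebra_simps)
    then have "V y = b *s w i + (1 + 1 / (b - \<mu>) * \<mu>) *s w (Suc i)"
      using Vnext by (simp add: y_def lin_rules[OF lin_V] \<mu>_def[symmetric] scale_left_distrib)
    ultimately have "V y = b *s y" by (simp add: y_def scale_right_distrib)
    then have "y \<in> D" using b D_def by blast
    then have "y - (1 / (b - \<mu>)) *s w (Suc i) \<in> span D"
      using next_D by (intro span_diff span_scale span_base)
    then show ?thesis by (simp add: y_def)
  qed
  have "w k \<in> span D"
    using wk span_minimal[of "w ` {..<k - 1}" "span D"] wD by blast
  \<comment> \<open>Invertibility of \<open>V - a\<close> on the span of \<open>D\<close>, eigenvector by eigenvector.\<close>
  then have "\<exists>y. y \<in> span D \<and> V y - a *s y = w k"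
  proof (induction rule: span_induct_alt)
    case base
    show ?case by (intro exI[of _ 0]) (simp add: lin_rules[OF lin_V] span_zero)
  next
    case (step s x z)
    then obtain b where b: "b \<noteq> a" "V x = b *s x" by (auto simp: D_def)
    obtain y where y: "y \<in> span D" "V y - a *s y = z" using step by blast
    define t where "t = s / (b - a)"
    have "V (t *s x + y) - a *s (t *s x + y) = (t * (b - a)) *s x + (V y - a *s y)"
      by (simp add: lin_rules[OF lin_V] b(2) algebra_simps)
    also have "\<dots> = s *s x + z" using b(1) y(2) by (simp add: t_def)
    finally have "V (t *s x + y) - a *s (t *s x + y) = s *s x + z" .
    moreover have "t *s x + y \<in> span D" using y(1) step.hyps by (simp add: span_add span_scale span_base)
    ultimately show ?case by blast
  qed
  then obtain y where y: "y \<in> span D" "V y - a *s y = w k" by blast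
  have power_eigen: "(V ^^ n) x = b ^ n *s x" if "V x = b *s x" for n b x
    by (induction n) (simp_all add: lin_rules[OF lin_V] that mult.commute)
  have lin_VN: "lin (V ^^ N)" by (rule lin_funpow[OF lin_V])
  have VN: "(V ^^ N) x = x" if "V x = b *s x" "b \<noteq> 0" for x b
    using power_eigen[OF that(1)] N[OF that(2)] by simp
  have VN_D: "(V ^^ N) x = x" if "x \<in> span D" for x
    by (rule lin_eq_on_span[OF lin_VN _ that]) (auto simp: D_def intro: VN linI)
  have last: "(V ^^ N) (w (k - 1)) = w (k - 1)"
  proof -
    have "V (w (k - 1)) = w k + a *s w (k - 1)"
      using \<open>0 < k\<close> by (simp add: Vw Ew a(2) algebra_simps)
    then have "V (w (k - 1) - y) = a *s (w (k - 1) - y)"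
      using y(2) by (simp add: lin_rules[OF lin_V] algebra_simps)
    from VN[OF this a(1)] show ?thesis using VN_D[OF y(1)] by (simp add: lin_rules[OF lin_VN])
  qed
  have "(V ^^ N) (P x) = P x" for x
  proof (rule basis_eq[of _ "\<lambda>x. x"])
    fix i assume "i < k"
    then show "(V ^^ N) (w i) = w i" using last VN_D[OF wD[of i]] by (cases "i = k - 1") auto
  qed (auto intro: lin_VN linI)
  then show ?thesis
    unfolding splits_def using lin_E lin_V EE PE
    by (intro exI[of _ E] exI[of _ V]) (auto simp: V_def E_def PD lin_rules[OF PD(1)])
qed

lemma splits_sum:
  assumes P: "summand P" and Q: "summand Q" and orth: "\<And>x. P (Q x) = 0" "\<And>x. Q (P x) = 0"
    and "splits N P" "splits N Q"
  shows "splits N (\<lambda>x. P x + Q x)"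
proof -
  note PD = summandD[OF P] and QD = summandD[OF Q]
  from \<open>splits N P\<close> obtain E V where 1: "lin E" "lin V"
    "\<And>x. E (E x) = E x" "\<And>x. P (E x) = E x" "\<And>x. E (P x) = E x" "\<And>x. P (V x) = V x"
    "\<And>x. V (P x) = V x" "\<And>x. (V ^^ N) (P x) = P x" "\<And>x. T (P x) = E x + V x"
    unfolding splits_def by metis
  from \<open>splits N Q\<close> obtain F W where 2: "lin F" "lin W"
    "\<And>x. F (F x) = F x" "\<And>x. Q (F x) = F x" "\<And>x. F (Q x) = F x" "\<And>x. Q (W x) = W x"
    "\<And>x. W (Q x) = W x" "\<And>x. (W ^^ N) (Q x) = Q x" "\<And>x. T (Q x) = F x + W x"
    unfolding splits_def by metis
  note rules = lin_rules[OF 1(1)] lin_rules[OF 1(2)] lin_rules[OF 2(1)] lin_rules[OF 2(2)]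
    lin_rules[OF PD(1)] lin_rules[OF QD(1)]
  have PQ: "P (F x) = 0" "P (W x) = 0" "Q (E x) = 0" "Q (V x) = 0" for x
    using orth 1(4,6) 2(4,6) by metis+
  have EQ: "E (Q x) = 0" "V (Q x) = 0" "F (P x) = 0" "W (P x) = 0" for x
    using orth 1(5,7) 2(5,7) rules by metis+
  have EF: "E (F x) = 0" "E (W x) = 0" "V (F x) = 0" "V (W x) = 0"
    "F (E x) = 0" "F (V x) = 0" "W (E x) = 0" "W (V x) = 0" for x
    using EQ 1(4,6) 2(4,6) by metis+
  have PV: "P ((V ^^ n) (P x)) = (V ^^ n) (P x)" "Q ((W ^^ n) (Q x)) = (W ^^ n) (Q x)" for n x
    by (cases n; simp add: 1 2 PD QD)+
  have power: "((\<lambda>x. V x + W x) ^^ n) (P x + Q x) = (V ^^ n) (P x) + (W ^^ n) (Q x)" for n x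
  proof (induction n)
    case (Suc n)
    have "V ((W ^^ n) (Q x)) = 0" "W ((V ^^ n) (P x)) = 0"
      using PV EQ by metis+
    then show ?case by (simp add: Suc rules)
  qed simp
  have "lin (\<lambda>x. E x + F x)" "lin (\<lambda>x. V x + W x)"
    by (rule linI; simp add: rules algebra_simps)+
  then show ?thesis
    unfolding splits_def
    by (intro exI[of _ "\<lambda>x. E x + F x"] exI[of _ "\<lambda>x. V x + W x"])
      (auto simp: rules 1 2 PQ EQ EF power T_rules)
qed

text \<open>A nonzero summand is either indecomposable, hence cyclic, or the sum of two summands with fewer elements.\<close>

theorem summand_splits:
  assumes two: "(2 :: 'f) \<noteq> 0" and big: "\<And>x y z :: 'f. \<exists>a. a \<notin> {x, y, z}"
    and N: "\<And>x :: 'f. x \<noteq> 0 \<Longrightarrow> x ^ N = 1"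
    and "summand P" "finite (range P)"
  shows "splits N P"
  using assms(4,5)
proof (induction "card (range P)" arbitrary: P rule: less_induct)
  case less
  note PD = summandD[OF less.prems(1)]
  consider "\<forall>x. P x = 0" | "indecomposable P" | Q where "\<exists>x. P x \<noteq> 0" "summand Q" "\<And>x. P (Q x) = Q x" "\<And>x. Q (P x) = Q x"
      "\<exists>x. Q x \<noteq> 0" "Q \<noteq> P"
    using less.prems(1) unfolding indecomposable_def by blast
  then show ?case
  proof cases
    case 1
    have "lin (\<lambda>_. 0)" by (rule linI) simp_all
    then show ?thesis using 1 lin_zero[OF lin_funpow] unfolding splits_def
      by (intro exI[of _ "\<lambda>_. 0"]) (auto simp: T_rules)
  next
    case 2
    obtain k v c where cyc: "0 < k" "P v = v" "\<And>g. g \<noteq> 0 \<Longrightarrow> degree g < k \<Longrightarrow> act g v \<noteq> 0"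
      "\<And>x. (T ^^ k) (P x) = (\<Sum>i<k. c i *s (T ^^ i) (P x))"
      using indecomposable_cyclic[OF 2 less.prems(2)] by blast
    obtain Q where Q: "summand Q" "\<And>x. P (Q x) = Q x" "\<And>x. Q (P x) = Q x" "Q v = v"
      "\<And>x. Q x \<in> span ((\<lambda>i. (T ^^ i) v) ` {..<k})"
      using cyclic_split_projection[OF less.prems(1) cyc] by blast
    have "v \<noteq> 0" using cyc(1) cyc(3)[of 1] by auto
    then have "Q = P" using 2 Q unfolding indecomposable_def by metis
    then show ?thesis using cyclic_splits[OF two big N less.prems(1) cyc] Q(5) by blast
  next
    case 3
    note QD = summandD[OF 3(2)]
    have smaller: "card (range R) < card (range P)" "finite (range R)"
      if R: "summand R" "\<And>x. P (R x) = R x" "\<And>x. R (P x) = R x" "R \<noteq> P" for R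
    proof -
      have sub: "range R \<subseteq> range P" using R(2) by (metis image_subsetI rangeI)
      moreover have "range R \<noteq> range P"
      proof
        assume eq: "range R = range P"
        have "R x = P x" for x
        proof -
          obtain y where "P x = R y" using eq by (metis rangeE rangeI)
          then show ?thesis using R summandD(2)[OF R(1)] by metis
        qed
        then show False using R(4) by blast
      qed
      ultimately show "card (range R) < card (range P)" using less.prems(2) by (simp add: psubset_card_mono psubsetI)
      show "finite (range R)" using sub less.prems(2) finite_subset by blast
    qed
    define R where "R x = P x - Q x" for x
    have R: "summand R" "\<And>x. P (R x) = R x" "\<And>x. R (P x) = R x"
      unfolding summand_def
      by (auto simp: R_def PD QD 3 T_rules lin_rules[OF PD(1)] lin_rules[OF QD(1)] algebra_simps intro!: linI)
    have "R \<noteq> P" using 3(5) by (auto simp: R_def fun_eq_iff)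
    have "splits N Q" "splits N R"
      using less.hyps smaller R 3 \<open>R \<noteq> P\<close> by blast+
    moreover have "Q (R x) = 0" "R (Q x) = 0" for x by (simp_all add: R_def lin_rules[OF QD(1)] QD 3)
    ultimately have "splits N (\<lambda>x. Q x + R x)" using splits_sum[OF 3(2) R(1)] by blast
    then show ?thesis by (simp add: R_def)
  qed
qed

end

section \<open>Matrices over a finite field\<close>

text \<open>Operators on column vectors of varying length are made operators on the one space \<open>nat \<Rightarrow> 'f\<close>; vectors of
length \<open>n\<close> are the range of the projection \<open>truncation n\<close>.\<close>

definition fscale :: "'f::field \<Rightarrow> (nat \<Rightarrow> 'f) \<Rightarrow> nat \<Rightarrow> 'f" where
  "fscale c x = (\<lambda>i. c * x i)"

lemma vector_space_fscale: "vector_space fscale"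
  by unfold_locales (auto simp: fscale_def fun_eq_iff algebra_simps)

definition operator_of_mat :: "'f::field mat \<Rightarrow> (nat \<Rightarrow> 'f) \<Rightarrow> nat \<Rightarrow> 'f" where
  "operator_of_mat A x = (\<lambda>i. if i < dim_row A then \<Sum>j<dim_col A. A $$ (i, j) * x j else 0)"

definition truncation :: "nat \<Rightarrow> (nat \<Rightarrow> 'f::field) \<Rightarrow> nat \<Rightarrow> 'f" where
  "truncation n x = (\<lambda>i. if i < n then x i else 0)"

definition mat_of_operator :: "nat \<Rightarrow> ((nat \<Rightarrow> 'f::field) \<Rightarrow> nat \<Rightarrow> 'f) \<Rightarrow> 'f mat" where
  "mat_of_operator n f = mat n n (\<lambda>(i, j). f (\<lambda>l. if l = j then 1 else 0) i)"

lemma mat_of_operator_carrier [simp]: "mat_of_operator n f \<in> carrier_mat n n"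
  by (simp add: mat_of_operator_def)

lemma mat_of_operator_comp:
  assumes f: "Vector_Spaces.linear fscale fscale f" "\<And>x. f (truncation n x) = f x"
  shows "mat_of_operator n (\<lambda>x. f (g x)) = mat_of_operator n f * mat_of_operator n g"
proof (rule eq_matI)
  fix i j assume "i < dim_row (mat_of_operator n f * mat_of_operator n g)"
    "j < dim_col (mat_of_operator n f * mat_of_operator n g)"
  then have ij: "i < n" "j < n" by (simp_all add: mat_of_operator_def)
  have f_add: "f (x + y) = f x + f y" and f_scale: "f (fscale c x) = fscale c (f x)" for x y c
    using f(1) by (simp_all add: Vector_Spaces.linear_iff)
  have f_0: "f 0 = 0" using f_scale[of 0 0] by (simp add: fscale_def zero_fun_def)
  have f_sum: "f (\<Sum>l\<in>A. h l) = (\<Sum>l\<in>A. f (h l))" for A :: "nat set" and h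
    by (induction A rule: infinite_finite_induct) (simp_all only: sum.infinite sum.empty sum.insert f_0 f_add not_False_eq_True)
  have sum_apply: "(\<Sum>l\<in>A. h l) m = (\<Sum>l\<in>A. h l m)"
    for A :: "nat set" and h :: "nat \<Rightarrow> nat \<Rightarrow> 'a" and m
    by (induction A rule: infinite_finite_induct) simp_all
  let ?y = "g (\<lambda>l. if l = j then 1 else 0)"
  have "truncation n ?y = (\<Sum>l<n. fscale (?y l) (\<lambda>m. if m = l then 1 else 0))"
  proof
    fix m
    have "(\<Sum>l<n. fscale (?y l) (\<lambda>m. if m = l then 1 else 0)) m
        = (\<Sum>l<n. if l = m then ?y m else 0)"
      unfolding sum_apply fscale_def by (rule sum.cong) auto
    then show "truncation n ?y m = (\<Sum>l<n. fscale (?y l) (\<lambda>m. if m = l then 1 else 0)) m"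
      by (simp add: truncation_def)
  qed
  then have "f (truncation n ?y) = (\<Sum>l<n. fscale (?y l) (f (\<lambda>m. if m = l then 1 else 0)))"
    by (simp only: f_sum f_scale)
  then have "f ?y = (\<Sum>l<n. fscale (?y l) (f (\<lambda>m. if m = l then 1 else 0)))"
    by (simp only: f(2))
  then have "f ?y i = (\<Sum>l<n. ?y l * f (\<lambda>m. if m = l then 1 else 0) i)"
    by (simp add: sum_apply fscale_def)
  then show "mat_of_operator n (\<lambda>x. f (g x)) $$ (i, j) = (mat_of_operator n f * mat_of_operator n g) $$ (i, j)"
    using ij by (simp add: mat_of_operator_def scalar_prod_def mult.commute lessThan_atLeast0)
qed (simp_all add: mat_of_operator_def)

lemma finite_range_truncation:
  assumes "finite (UNIV :: 'f::field set)"
  shows "finite (range (truncation n :: (nat \<Rightarrow> 'f) \<Rightarrow> _))"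
proof -
  have "finite {f :: nat \<Rightarrow> 'f. \<forall>i. (i \<in> {..<n} \<longrightarrow> f i \<in> UNIV) \<and> (i \<notin> {..<n} \<longrightarrow> f i = 0)}"
    by (rule finite_set_of_finite_funs) (use assms in auto)
  then show ?thesis by (rule finite_subset[rotated]) (auto simp: truncation_def)
qed

theorem field_mat_splits:
  fixes A :: "'f::field mat"
  assumes two: "(2 :: 'f) \<noteq> 0" and big: "\<And>x y z :: 'f. \<exists>a. a \<notin> {x, y, z}"
    and N: "\<And>x :: 'f. x \<noteq> 0 \<Longrightarrow> x ^ N = 1" and fin: "finite (UNIV :: 'f set)"
    and A: "A \<in> carrier_mat n n"
  shows "\<exists>E\<in>carrier_mat n n. \<exists>V\<in>carrier_mat n n. E * E = E \<and> V ^\<^sub>m N = 1\<^sub>m n \<and> A = E + V"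
proof -
  let ?T = "operator_of_mat A" and ?P = "truncation n"
  interpret endomorphism fscale ?T
  proof (intro endomorphism.intro endomorphism_axioms.intro vector_space_fscale)
    show "Vector_Spaces.linear fscale fscale ?T"
      by (auto simp: Vector_Spaces.linear_iff vector_space_fscale operator_of_mat_def fscale_def fun_eq_iff
          algebra_simps sum.distrib sum_distrib_left)
  qed
  have "summand ?P"
    unfolding summand_def using A
    by (auto intro!: linI simp: truncation_def operator_of_mat_def fscale_def fun_eq_iff)
  then have "splits N ?P" using summand_splits[OF two big N] finite_range_truncation[OF fin] by blast
  then obtain E V where E: "lin E" "\<And>x. E (E x) = E x" "\<And>x. E (?P x) = E x"
    and V: "lin V" "\<And>x. V (?P x) = V x" "\<And>x. ?P (V x) = V x" "\<And>x. (V ^^ N) (?P x) = ?P x"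
    and sum: "\<And>x. ?T (?P x) = E x + V x"
    unfolding splits_def by metis
  let ?m = "mat_of_operator n"
  have "?m E * ?m E = ?m E"
    by (simp only: mat_of_operator_comp[where f = E and g = E and n = n, OF E(1) E(3), symmetric] E(2))
  moreover have id: "?m (\<lambda>x. ?P x) = 1\<^sub>m n"
    by (rule eq_matI) (auto simp: mat_of_operator_def truncation_def)
  have power: "?m V ^\<^sub>m l = ?m (\<lambda>x. (V ^^ l) (?P x))" for l
  proof (induction l)
    case 0
    have "dim_row (?m V) = n" by (simp add: mat_of_operator_def)
    then show ?case by (simp only: pow_mat.simps funpow.simps id_apply id)
  next
    case (Suc l)
    have "?m (\<lambda>x. (V ^^ l) (?P (V x))) = ?m (\<lambda>x. (V ^^ l) (?P x)) * ?m V"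
    proof (rule mat_of_operator_comp[where f = "\<lambda>x. (V ^^ l) (?P x)" and g = V])
      show "lin (\<lambda>x. (V ^^ l) (?P x))"
        using lin_compose[OF lin_funpow[OF V(1), of l] summandD(1)[OF \<open>summand ?P\<close>]] .
      show "(V ^^ l) (?P (?P x)) = (V ^^ l) (?P x)" for x
        by (simp only: summandD(2)[OF \<open>summand ?P\<close>])
    qed
    then show ?case by (simp add: Suc V(2,3) funpow_swap1)
  qed
  have "?m V ^\<^sub>m N = 1\<^sub>m n"
    by (simp only: power V(4) id)
  moreover have "A = ?m E + ?m V"
  proof (rule eq_matI)
    fix i j assume "i < dim_row (?m E + ?m V)" "j < dim_col (?m E + ?m V)"
    then have ij: "i < n" "j < n" by (simp_all add: mat_of_operator_def)
    let ?e = "\<lambda>l. if l = j then 1 else 0 :: 'f"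
    have "E ?e i + V ?e i = ?T (?P ?e) i" by (simp add: sum)
    also have "\<dots> = (\<Sum>l<n. A $$ (i, l) * ?P ?e l)"
      using ij A by (simp add: operator_of_mat_def)
    also have "\<dots> = (\<Sum>l<n. if l = j then A $$ (i, j) else 0)"
      by (rule sum.cong) (auto simp: truncation_def)
    finally show "A $$ (i, j) = (?m E + ?m V) $$ (i, j)" using ij by (simp add: mat_of_operator_def)
  qed (use A in \<open>simp_all add: mat_of_operator_def\<close>)
  ultimately show ?thesis by (intro bexI[of _ "?m E"] bexI[of _ "?m V"]) simp_all
qed

section \<open>Splitting scalar matrices\<close>

text \<open>From \<open>V = x I - E\<close> follow \<open>V E = (x - 1) E\<close> and \<open>V (I - E) = x (I - E)\<close>, and \<open>V\<^sup>q = V\<close> turns these into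
relations for \<open>E\<close>. One diagonal entry \<open>e\<close> of \<open>E\<close> carries all that is needed.\<close>

lemma scalar_mat_split:
  fixes x :: "'a::comm_ring_1"
  assumes "0 < n" and split: "sum_idem_q_potent q n (x \<cdot>\<^sub>m 1\<^sub>m n)"
  obtains e where "(x ^ q - x) * (1 - e) = 0" "((x - 1) ^ q - (x - 1)) * e = 0"
proof -
  obtain E V where E: "E \<in> carrier_mat n n" "E * E = E" and V: "V \<in> carrier_mat n n" "V ^\<^sub>m q = V"
    and sum: "x \<cdot>\<^sub>m 1\<^sub>m n = E + V"
    using split by (auto simp: sum_idem_q_potent_def idempotent_mat_def q_potent_mat_def)
  have "V $$ (i, j) = (x \<cdot>\<^sub>m 1\<^sub>m n - E) $$ (i, j)" if "i < n" "j < n" for i j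
    using that E V by (simp add: sum)
  then have V_eq: "V = x \<cdot>\<^sub>m 1\<^sub>m n - E" using E V by (intro eq_matI) auto
  have eigen: "(c ^ q - c) \<cdot>\<^sub>m G = 0\<^sub>m n n" if G: "G \<in> carrier_mat n n" and VG: "V * G = c \<cdot>\<^sub>m G" for c G
  proof -
    have "V ^\<^sub>m k * G = c ^ k \<cdot>\<^sub>m G" for k
    proof (induction k)
      case 0
      show ?case using G V by (intro eq_matI) auto
    next
      case (Suc k)
      have "V ^\<^sub>m Suc k * G = V ^\<^sub>m k * (V * G)" using V G by (simp add: assoc_mult_mat[of _ n n _ n _ n])
      also have "\<dots> = c \<cdot>\<^sub>m (V ^\<^sub>m k * G)" using V G by (simp add: VG mult_smult_distrib[of _ n n _ n])
      also have "\<dots> = c ^ Suc k \<cdot>\<^sub>m G" using G by (intro eq_matI) (auto simp: Suc mult.assoc)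
      finally show ?case .
    qed
    from this[of q] have "c ^ q \<cdot>\<^sub>m G = c \<cdot>\<^sub>m G" by (simp add: V VG)
    moreover have "(c ^ q \<cdot>\<^sub>m G) $$ (i, j) = c ^ q * G $$ (i, j)" "(c \<cdot>\<^sub>m G) $$ (i, j) = c * G $$ (i, j)"
      if "i < n" "j < n" for i j using that G by auto
    ultimately have "c ^ q * G $$ (i, j) = c * G $$ (i, j)" if "i < n" "j < n" for i j
      using that by metis
    then show ?thesis using G by (intro eq_matI) (auto simp: left_diff_distrib)
  qed
  have xE: "(x \<cdot>\<^sub>m 1\<^sub>m n) * G = x \<cdot>\<^sub>m G" if "G \<in> carrier_mat n n" for G
    using that by (simp add: mult_smult_assoc_mat[of _ n n _ n])
  let ?G = "1\<^sub>m n - E"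
  have "V * E = x \<cdot>\<^sub>m E - E" using E by (simp add: V_eq minus_mult_distrib_mat[of _ n n _ _ n] xE)
  also have "\<dots> = (x - 1) \<cdot>\<^sub>m E" using E by (intro eq_matI) (auto simp: left_diff_distrib)
  finally have 1: "((x - 1) ^ q - (x - 1)) \<cdot>\<^sub>m E = 0\<^sub>m n n" using eigen E by blast
  have G: "?G \<in> carrier_mat n n" using E by (simp add: minus_carrier_mat)
  have "V * ?G = (x \<cdot>\<^sub>m 1\<^sub>m n) * ?G - E * ?G"
    unfolding V_eq by (rule minus_mult_distrib_mat) (use E G in auto)
  also have "(x \<cdot>\<^sub>m 1\<^sub>m n) * ?G = x \<cdot>\<^sub>m ?G" by (rule xE[OF G])
  also have "E * ?G = 0\<^sub>m n n" using E by (simp add: mult_minus_distrib_mat[of _ n n _ n])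
  also have "x \<cdot>\<^sub>m ?G - 0\<^sub>m n n = x \<cdot>\<^sub>m ?G" using E by (intro eq_matI) auto
  finally have 2: "(x ^ q - x) \<cdot>\<^sub>m ?G = 0\<^sub>m n n" using eigen G by blast
  have "(((x - 1) ^ q - (x - 1)) \<cdot>\<^sub>m E) $$ (0, 0) = 0" using 1 \<open>0 < n\<close> by simp
  moreover have "((x ^ q - x) \<cdot>\<^sub>m ?G) $$ (0, 0) = 0" using 2 \<open>0 < n\<close> by simp
  ultimately show thesis using that[of "E $$ (0, 0)"] E \<open>0 < n\<close> by simp
qed

lemma one_minus_power_expansion:
  fixes x :: "'a::comm_ring_1"
  shows "\<exists>h. (1 - x) ^ m = 1 - of_nat m * x + x\<^sup>2 * h"
proof (induction m)
  case (Suc m)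
  then obtain h where "(1 - x) ^ m = 1 - of_nat m * x + x\<^sup>2 * h" by blast
  then have "(1 - x) ^ Suc m = (1 - x) * (1 - of_nat m * x + x\<^sup>2 * h)" by simp
  also have "\<dots> = 1 - of_nat (Suc m) * x + x\<^sup>2 * (of_nat m + (1 - x) * h)"
    by (simp add: power2_eq_square algebra_simps)
  finally have "(1 - x) ^ Suc m = 1 - of_nat (Suc m) * x + x\<^sup>2 * (of_nat m + (1 - x) * h)" .
  then show ?case by blast
qed (rule exI[of _ 0], simp)

text \<open>Put \<open>a = x\<^sup>q - x\<close>; the aim is \<open>a = 0\<close>. Equations multiplied by \<open>a\<close> express what holds where \<open>x\<close> is not a root
of \<open>t\<^sup>q - t\<close>. There \<open>x - 1\<close> is a nonzero root, so \<open>(1 - x)\<^sup>m = 1\<close> with \<open>m = q - 1\<close> (this is \<open>az\<close>). Expanding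
the power and using that \<open>m\<close> is a unit shows that \<open>x\<close> has an inverse \<open>y\<close> there (this is \<open>axy\<close>). As \<open>y\<close> is not
a root either, \<open>y - 1\<close> is one, and \<open>x (y - 1) = 1 - x\<close> then makes \<open>x\<close> itself a root. Squares that vanish
can be cancelled since the ring is reduced.\<close>

lemma identity_of_scalar_splits:
  fixes x w :: "'a::comm_ring_1"
  assumes split: "\<And>x :: 'a. \<exists>e. (x ^ q - x) * (1 - e) = 0 \<and> ((x - 1) ^ q - (x - 1)) * e = 0"
    and q: "q = Suc m" "even m" "0 < m" and w: "w * of_nat m = 1"
  shows "x ^ q = x"
proof -
  have even_power: "(y - 1) ^ m = (1 - y) ^ m" for y :: 'a
    using q(2) by (metis minus_diff_eq power_minus_even)
  have reduced: "y = 0" if y: "y * y = 0" for y :: 'a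
  proof -
    obtain e where e: "(y ^ q - y) * (1 - e) = 0" "((y - 1) ^ q - (y - 1)) * e = 0" using split by blast
    obtain m' where "m = Suc m'" using q(3) gr0_implies_Suc by blast
    then have "y ^ q = 0" using y q by (simp add: mult.assoc[symmetric])
    then have ye: "y = y * e" using e(1) by (simp add: algebra_simps)
    obtain h where "(1 - y) ^ m = 1 - of_nat m * y + y\<^sup>2 * h" using one_minus_power_expansion by blast
    then have "(1 - y) ^ m = 1 - of_nat m * y" using y by (simp add: power2_eq_square)
    moreover have "(y - 1) ^ q - (y - 1) = (y - 1) * ((1 - y) ^ m - 1)"
      by (simp add: q even_power right_diff_distrib)
    ultimately have "(y - 1) ^ q - (y - 1) = (y - 1) * (- (of_nat m * y))" by simp
    also have "\<dots> = of_nat m * y - of_nat m * (y * y)" by (simp add: algebra_simps)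
    also have "\<dots> = of_nat m * y" using y by simp
    finally have "w * of_nat m * (y * e) = 0" using e(2) by (simp add: mult.assoc)
    then show ?thesis using ye w by simp
  qed
  have f_prod: "(y ^ q - y) * ((y - 1) ^ q - (y - 1)) = 0" for y :: 'a
  proof -
    obtain e where e: "(y ^ q - y) * (1 - e) = 0" "((y - 1) ^ q - (y - 1)) * e = 0" using split by blast
    have "(y ^ q - y) * ((y - 1) ^ q - (y - 1)) = (y ^ q - y) * (1 - e) * ((y - 1) ^ q - (y - 1))
        + (y ^ q - y) * (((y - 1) ^ q - (y - 1)) * e)"
      by (simp add: algebra_simps)
    then show ?thesis using e by simp
  qed
  define a where "a = x ^ q - x"
  define u where "u = x - 1"
  define z where "z = (1 - x) ^ m - 1"
  have a_x: "a = x * (x ^ m - 1)" by (simp add: a_def q algebra_simps)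
  have "x ^ m - 1 = (x - 1) * (\<Sum>i<m. x ^ i)" by (rule power_diff_1_eq)
  then obtain c where a_u: "a = u * c" using a_x u_def by (metis mult.left_commute)
  have az: "a * z = 0"
  proof (rule reduced)
    have "(x - 1) ^ q - (x - 1) = u * z" by (simp add: q even_power u_def z_def algebra_simps)
    then have "a * (u * z) = 0" using f_prod[of x] a_def by simp
    moreover have "(a * z) * (a * z) = c * z * (a * (u * z))"
      by (subst (2) a_u) (simp only: mult_ac)
    ultimately show "(a * z) * (a * z) = 0" by simp
  qed
  obtain h where "(1 - x) ^ m = 1 - of_nat m * x + x\<^sup>2 * h" using one_minus_power_expansion by blast
  then have z_x: "z = - x * (of_nat m - x * h)" by (simp add: z_def power2_eq_square algebra_simps)
  have "a * (of_nat m - x * h) = 0"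
  proof (rule reduced)
    let ?t = "of_nat m - x * h"
    have "(a * ?t) * (a * ?t) = - ((x ^ m - 1) * ?t * (a * z))"
      by (subst (2) a_x) (simp only: z_x mult_ac mult_minus_left mult_minus_right minus_minus)
    then show "(a * ?t) * (a * ?t) = 0" by (simp add: az)
  qed
  \<comment> \<open>The inverse of \<open>x\<close> read off from \<open>a (m - x h) = 0\<close>.\<close>
  define y where "y = w * h"
  have axy: "a * (x * y) = a"
  proof -
    have "a * (x * y) = w * of_nat m * a - w * (a * (of_nat m - x * h))"
      by (simp add: y_def algebra_simps)
    then show ?thesis using \<open>a * (of_nat m - x * h) = 0\<close> w by simp
  qed
  have axy_power: "a * (x * y - s) ^ k = a * (1 - s) ^ k" for s k
  proof (induction k)
    case (Suc k)
    have "a * (x * y - s) ^ Suc k = (x * y - s) * (a * (x * y - s) ^ k)" by simp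
    also have "\<dots> = (a * (x * y) - a * s) * (1 - s) ^ k" by (simp add: Suc algebra_simps)
    also have "\<dots> = a * (1 - s) ^ Suc k" by (simp add: axy algebra_simps)
    finally show ?case .
  qed simp
  have "a * x ^ Suc q * (y ^ q - y) = x * (a * (x * y - 0) ^ q) - x ^ q * (a * (x * y))"
    by (simp add: power_mult_distrib algebra_simps)
  also have "\<dots> = x * (a * (1 - 0) ^ q) - x ^ q * a" by (simp only: axy_power axy)
  also have "\<dots> = - (a * a)" by (simp add: a_def algebra_simps)
  finally have "a * a * ((y - 1) ^ q - (y - 1)) = - (a * x ^ Suc q * ((y ^ q - y) * ((y - 1) ^ q - (y - 1))))"
    by (simp add: mult.assoc[symmetric])
  then have "a * a * ((y - 1) ^ q - (y - 1)) = 0" by (simp add: f_prod)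
  moreover have "x ^ q * (a * a * ((y - 1) ^ q - (y - 1)))
      = a * (a * (x ^ q * (y - 1) ^ q)) - a * x ^ m * (a * (x * y) - a * x)"
    by (simp add: q algebra_simps)
  ultimately have "0 = a * (a * (x ^ q * (y - 1) ^ q)) - a * x ^ m * (a * (x * y) - a * x)"
    by simp
  also have "x ^ q * (y - 1) ^ q = (x * y - x) ^ q" by (simp add: power_mult_distrib[symmetric] algebra_simps)
  also have "a * (a * (x * y - x) ^ q) - a * x ^ m * (a * (x * y) - a * x)
      = a * a * (1 - x) ^ q - a * x ^ m * (a - a * x)"
    by (simp add: axy_power axy)
  also have "\<dots> = a * (1 - x) * (a * z + a - a * x ^ m)" by (simp add: q z_def algebra_simps)
  also have "\<dots> = a * a * (1 - x) * (1 - x ^ m)" by (simp add: az algebra_simps)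
  finally have "a * a * (1 - x) * (1 - x ^ m) = 0" by simp
  moreover have "(a * a) * ((x * (x ^ m - 1)) * ((x - 1) * c)) = x * c * (a * a * (1 - x) * (1 - x ^ m))"
    by (simp add: algebra_simps)
  then have "(a * a) * (a * a) = x * c * (a * a * (1 - x) * (1 - x ^ m))"
    by (simp only: a_x[symmetric] a_u[unfolded u_def, symmetric])
  ultimately have "(a * a) * (a * a) = 0" by simp
  then have "a = 0" using reduced by blast
  then show ?thesis by (simp add: a_def)
qed

section \<open>From maximal ideals to the ring\<close>

definition is_ideal :: "'a::comm_ring_1 set \<Rightarrow> bool" where
  "is_ideal I \<longleftrightarrow> 0 \<in> I \<and> (\<forall>x\<in>I. \<forall>y\<in>I. x + y \<in> I) \<and> (\<forall>r. \<forall>x\<in>I. r * x \<in> I)"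

definition is_maximal_ideal :: "'a::comm_ring_1 set \<Rightarrow> bool" where
  "is_maximal_ideal M \<longleftrightarrow> is_ideal M \<and> 1 \<notin> M \<and> (\<forall>J. is_ideal J \<and> 1 \<notin> J \<and> M \<subseteq> J \<longrightarrow> J = M)"

lemma proper_ideal_in_maximal:
  assumes "is_ideal I" "1 \<notin> I"
  obtains M where "is_maximal_ideal M" "I \<subseteq> M"
proof -
  let ?A = "{J. is_ideal J \<and> 1 \<notin> J \<and> I \<subseteq> J}"
  have "\<exists>M\<in>?A. \<forall>X\<in>?A. M \<subseteq> X \<longrightarrow> X = M"
  proof (rule subset_Zorn_nonempty)
    show "?A \<noteq> {}" using assms by blast
    fix C assume C: "C \<noteq> {}" "subset.chain ?A C"
    then have sub: "\<And>J. J \<in> C \<Longrightarrow> is_ideal J \<and> 1 \<notin> J \<and> I \<subseteq> J"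
      and tot: "\<And>J K. J \<in> C \<Longrightarrow> K \<in> C \<Longrightarrow> J \<subseteq> K \<or> K \<subseteq> J"
      by (auto simp: subset_chain_def)
    have "is_ideal (\<Union>C)"
      unfolding is_ideal_def
    proof (intro conjI ballI allI)
      show "0 \<in> \<Union>C" using C(1) sub by (auto simp: is_ideal_def)
      fix x assume x: "x \<in> \<Union>C"
      show "r * x \<in> \<Union>C" for r using x sub unfolding is_ideal_def by blast
      fix y assume y: "y \<in> \<Union>C"
      obtain J K where "x \<in> J" "J \<in> C" "y \<in> K" "K \<in> C" using x y by blast
      then obtain L where "x \<in> L" "y \<in> L" "L \<in> C" using tot by blast
      then show "x + y \<in> \<Union>C" using sub unfolding is_ideal_def by blast
    qed
    then show "\<Union>C \<in> ?A" using C(1) sub by blast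
  qed
  then obtain M where M: "is_ideal M" "1 \<notin> M" "I \<subseteq> M" and max: "\<forall>X\<in>?A. M \<subseteq> X \<longrightarrow> X = M"
    by auto
  have "J = M" if "is_ideal J" "1 \<notin> J" "M \<subseteq> J" for J
    using max that M(3) by (metis (no_types, lifting) mem_Collect_eq subset_trans)
  then show thesis using M by (intro that[of M]) (auto simp: is_maximal_ideal_def)
qed

definition splits_mod :: "'a::comm_ring_1 set \<Rightarrow> nat \<Rightarrow> nat \<Rightarrow> 'a mat \<Rightarrow> bool" where
  "splits_mod M N n A \<longleftrightarrow> (\<exists>E\<in>carrier_mat n n. \<exists>V\<in>carrier_mat n n. \<forall>i<n. \<forall>j<n.
     (E * E) $$ (i, j) - E $$ (i, j) \<in> M \<and> (V ^\<^sub>m N) $$ (i, j) - 1\<^sub>m n $$ (i, j) \<in> M \<and>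
     A $$ (i, j) - (E $$ (i, j) + V $$ (i, j)) \<in> M)"

lemma glue_index:
  assumes "A \<in> carrier_mat n n" "B \<in> carrier_mat n n" "i < n" "j < n"
  shows "(e \<cdot>\<^sub>m A + (1 - e :: 'a::comm_ring_1) \<cdot>\<^sub>m B) $$ (i, j) = e * A $$ (i, j) + (1 - e) * B $$ (i, j)"
  using assms by auto

text \<open>For an idempotent \<open>e\<close>, matrices over the ring are pairs of matrices over the two factors it
defines, and \<open>e \<cdot>\<^sub>m A + (1 - e) \<cdot>\<^sub>m B\<close> is the pair of \<open>A\<close> and \<open>B\<close>; products are formed componentwise.\<close>

lemma glue_mult:
  fixes e :: "'a::comm_ring_1"
  assumes "e * e = e" "A \<in> carrier_mat n n" "B \<in> carrier_mat n n" "C \<in> carrier_mat n n" "D \<in> carrier_mat n n"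
  shows "(e \<cdot>\<^sub>m A + (1 - e) \<cdot>\<^sub>m B) * (e \<cdot>\<^sub>m C + (1 - e) \<cdot>\<^sub>m D) = e \<cdot>\<^sub>m (A * C) + (1 - e) \<cdot>\<^sub>m (B * D)"
proof (rule eq_matI)
  fix i j assume "i < dim_row (e \<cdot>\<^sub>m (A * C) + (1 - e) \<cdot>\<^sub>m (B * D))"
    "j < dim_col (e \<cdot>\<^sub>m (A * C) + (1 - e) \<cdot>\<^sub>m (B * D))"
  then have ij: "i < n" "j < n" using assms by auto
  have "(e * a + (1 - e) * b) * (e * c + (1 - e) * d)
      = e * (a * c) + (1 - e) * (b * d) + (e * e - e) * ((a - b) * (c - d))" for a b c d
    by (simp add: algebra_simps)
  then have "(e * a + (1 - e) * b) * (e * c + (1 - e) * d) = e * (a * c) + (1 - e) * (b * d)" for a b c d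
    by (simp add: assms(1))
  then show "((e \<cdot>\<^sub>m A + (1 - e) \<cdot>\<^sub>m B) * (e \<cdot>\<^sub>m C + (1 - e) \<cdot>\<^sub>m D)) $$ (i, j)
      = (e \<cdot>\<^sub>m (A * C) + (1 - e) \<cdot>\<^sub>m (B * D)) $$ (i, j)"
    using ij assms(2-) by (simp add: scalar_prod_def sum.distrib sum_distrib_left)
qed (use assms in auto)

lemma glue_power:
  fixes e :: "'a::comm_ring_1"
  assumes "e * e = e" "A \<in> carrier_mat n n" "B \<in> carrier_mat n n"
  shows "(e \<cdot>\<^sub>m A + (1 - e) \<cdot>\<^sub>m B) ^\<^sub>m k = e \<cdot>\<^sub>m (A ^\<^sub>m k) + (1 - e) \<cdot>\<^sub>m (B ^\<^sub>m k)"
proof (induction k)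
  case 0
  show ?case using assms by (intro eq_matI) (auto simp: algebra_simps)
next
  case (Suc k)
  then show ?case
    using glue_mult[OF assms(1) pow_carrier_mat[OF assms(2), of k] pow_carrier_mat[OF assms(3), of k] assms(2,3)]
    by simp
qed

lemma glue_one: "e \<cdot>\<^sub>m 1\<^sub>m n + (1 - e :: 'a::comm_ring_1) \<cdot>\<^sub>m 1\<^sub>m n = 1\<^sub>m n"
  by (rule eq_matI) (auto simp: algebra_simps)

text \<open>Elements with \<open>z\<^sup>N\<^sup>+\<^sup>1 = z\<close> are idempotents up to a unit factor: \<open>z\<^sup>N\<close> generates the same ideal as \<open>z\<close>.\<close>

lemma power_idempotent:
  fixes z :: "'a::comm_ring_1"
  assumes "z ^ Suc N = z" "0 < N"
  shows "z ^ N * z = z" "z ^ N * z ^ N = z ^ N"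
proof -
  show *: "z ^ N * z = z" using assms(1) by (simp add: mult.commute)
  obtain N' where N': "N = Suc N'" using \<open>0 < N\<close> gr0_implies_Suc by blast
  have "z ^ N * z ^ N = (z ^ N * z) * z ^ N'" by (simp add: N' mult.assoc)
  also have "\<dots> = z ^ N" unfolding * by (simp add: N')
  finally show "z ^ N * z ^ N = z ^ N" .
qed

text \<open>Finitely many elements of an ideal are multiples of a single idempotent of that ideal: the join of
two idempotents \<open>g\<close> and \<open>e\<close> is \<open>g + (1 - g) e\<close>.\<close>

lemma local_unit:
  fixes M :: "'a::comm_ring_1 set"
  assumes pow: "\<And>x :: 'a. x ^ Suc N = x" and "0 < N" and M: "is_ideal M" and "finite S" "S \<subseteq> M"
  shows "\<exists>g\<in>M. g * g = g \<and> (\<forall>z\<in>S. g * z = z)"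
  using assms(4,5)
proof (induction S rule: finite_induct)
  case empty
  then show ?case using M by (intro bexI[of _ 0]) (auto simp: is_ideal_def)
next
  case (insert z S)
  then obtain g where g: "g \<in> M" "g * g = g" "\<forall>z\<in>S. g * z = z" by auto
  define e where "e = z ^ N"
  obtain N' where N': "N = Suc N'" using \<open>0 < N\<close> gr0_implies_Suc by blast
  have ez: "e * z = z" and ee: "e * e = e"
    using power_idempotent[OF pow \<open>0 < N\<close>] by (simp_all only: e_def)
  have "z ^ N' * z \<in> M" using insert.prems M unfolding is_ideal_def by blast
  then have "e \<in> M" by (simp add: e_def N' mult.commute)
  have "(1 - g) * e \<in> M" "g \<in> M" using \<open>e \<in> M\<close> g M by (auto simp: is_ideal_def)
  then have "g + (1 - g) * e \<in> M" using M by (auto simp: is_ideal_def)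
  moreover have "(g + (1 - g) * e) * (g + (1 - g) * e)
      = g + (1 - g) * e - (g - g * g) * (1 - e) - (1 - g) * (1 - g) * (e - e * e)"
    by (simp add: algebra_simps)
  then have "(g + (1 - g) * e) * (g + (1 - g) * e) = g + (1 - g) * e" by (simp add: g(2) ee)
  moreover have "(g + (1 - g) * e) * z = g * z + (1 - g) * (e * z)" by (simp only: distrib_right mult.assoc)
  then have "(g + (1 - g) * e) * z = z" by (simp add: ez algebra_simps)
  moreover have "(g + (1 - g) * e) * y = y" if "y \<in> S" for y
  proof -
    have "(g + (1 - g) * e) * y = y - (1 - e) * (y - g * y)" by (simp add: algebra_simps)
    then show ?thesis using g(3) that by simp
  qed
  ultimately show ?case by blast
qed

text \<open>Two partial solutions, valid after multiplication by \<open>x\<close> and by \<open>y\<close>, are glued along the idempotent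
\<open>x\<^sup>N\<close> to one that is valid for \<open>x + y\<close>, so the multipliers \<open>x\<close> admitting a solution form an ideal \<open>I\<close>. Suppose that \<open>I\<close>
is contained in a maximal ideal \<open>M\<close>. The finitely many elements of \<open>M\<close> by which a solution modulo
\<open>M\<close> fails to be a solution are fixed by some idempotent \<open>g \<in> M\<close>; on the complementary factor it is a
solution, which puts \<open>1 - g\<close> into \<open>I \<subseteq> M\<close> and hence \<open>1\<close> into \<open>M\<close>.\<close>

theorem splits_if_splits_mod_maximal:
  fixes A :: "'a::comm_ring_1 mat"
  assumes pow: "\<And>x :: 'a. x ^ Suc N = x" and "0 < N" and A: "A \<in> carrier_mat n n"
    and local: "\<And>M :: 'a set. is_maximal_ideal M \<Longrightarrow> splits_mod M N n A"
  shows "\<exists>E\<in>carrier_mat n n. \<exists>V\<in>carrier_mat n n. E * E = E \<and> V ^\<^sub>m N = 1\<^sub>m n \<and> A = E + V"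
proof (rule ccontr)
  assume not_split: "\<not> ?thesis"
  define good where "good x E V \<longleftrightarrow> E \<in> carrier_mat n n \<and> V \<in> carrier_mat n n \<and> E * E = E \<and> V ^\<^sub>m N = 1\<^sub>m n \<and>
    (\<forall>i<n. \<forall>j<n. x * (A $$ (i, j) - (E $$ (i, j) + V $$ (i, j))) = 0)" for x E V
  define I where "I = {x. \<exists>E V. good x E V}"
  have one_pow: "1\<^sub>m n ^\<^sub>m k = (1\<^sub>m n :: 'a mat)" for k by (induction k) simp_all
  have ideal_I: "is_ideal I"
    unfolding is_ideal_def
  proof (intro conjI ballI allI)
    have "good 0 (0\<^sub>m n n) (1\<^sub>m n)" by (simp add: good_def one_pow)
    then show "0 \<in> I" by (auto simp: I_def)
    fix x assume "x \<in> I"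
    then obtain E1 V1 where 1: "good x E1 V1" by (auto simp: I_def)
    then have "good (r * x) E1 V1" for r by (simp add: good_def mult.assoc)
    then show "r * x \<in> I" for r by (auto simp: I_def)
    fix y assume "y \<in> I"
    then obtain E2 V2 where 2: "good y E2 V2" by (auto simp: I_def)
    obtain N' where N': "N = Suc N'" using \<open>0 < N\<close> gr0_implies_Suc by blast
    define e where "e = x ^ N"
    have ex: "e * x = x" and ee: "e * e = e"
      using power_idempotent[OF pow \<open>0 < N\<close>] by (simp_all only: e_def)
    let ?E = "e \<cdot>\<^sub>m E1 + (1 - e) \<cdot>\<^sub>m E2" and ?V = "e \<cdot>\<^sub>m V1 + (1 - e) \<cdot>\<^sub>m V2"
    have car: "E1 \<in> carrier_mat n n" "V1 \<in> carrier_mat n n" "E2 \<in> carrier_mat n n" "V2 \<in> carrier_mat n n"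
      using 1 2 by (simp_all add: good_def)
    have "(x + y) * (A $$ (i, j) - (?E $$ (i, j) + ?V $$ (i, j))) = 0" if ij: "i < n" "j < n" for i j
    proof -
      define \<alpha> where "\<alpha> = A $$ (i, j) - (E1 $$ (i, j) + V1 $$ (i, j))"
      define \<beta> where "\<beta> = A $$ (i, j) - (E2 $$ (i, j) + V2 $$ (i, j))"
      have "x * \<alpha> = 0" "y * \<beta> = 0" using 1 2 ij by (auto simp: good_def \<alpha>_def \<beta>_def)
      moreover have "e * \<alpha> = x ^ N' * (x * \<alpha>)" by (simp add: e_def N' mult_ac)
      moreover have "A $$ (i, j) - (?E $$ (i, j) + ?V $$ (i, j)) = e * \<alpha> + (1 - e) * \<beta>"
        using car ij by (simp add: \<alpha>_def \<beta>_def algebra_simps)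
      moreover have "(x + y) * (e * \<alpha> + (1 - e) * \<beta>)
          = (x + y) * (e * \<alpha>) + (x - e * x) * \<beta> + (1 - e) * (y * \<beta>)"
        by (simp add: algebra_simps)
      ultimately show ?thesis by (simp add: ex)
    qed
    moreover have "?E * ?E = ?E" "?V ^\<^sub>m N = 1\<^sub>m n"
      using 1 2 glue_mult[OF ee, of E1 n E2 E1 E2] glue_power[OF ee, of V1 n V2 N] glue_one
      by (simp_all add: good_def)
    ultimately have "good (x + y) ?E ?V" using 1 2 by (simp add: good_def)
    then show "x + y \<in> I" by (auto simp: I_def)
  qed
  have one_notin_I: "1 \<notin> I"
  proof
    assume "1 \<in> I"
    then obtain E V where g: "good 1 E V" by (auto simp: I_def)
    then have "A = E + V" using A by (intro eq_matI) (auto simp: good_def)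
    then show False using g not_split by (auto simp: good_def)
  qed
  obtain M where M: "is_maximal_ideal M" "I \<subseteq> M"
    using proper_ideal_in_maximal[OF ideal_I one_notin_I] by blast
  obtain E V where E: "E \<in> carrier_mat n n" and V: "V \<in> carrier_mat n n"
    and mod: "\<And>i j. i < n \<Longrightarrow> j < n \<Longrightarrow> (E * E) $$ (i, j) - E $$ (i, j) \<in> M \<and>
      (V ^\<^sub>m N) $$ (i, j) - 1\<^sub>m n $$ (i, j) \<in> M \<and> A $$ (i, j) - (E $$ (i, j) + V $$ (i, j)) \<in> M"
    using local[OF M(1)] unfolding splits_mod_def by blast
  define S where "S = (\<Union>i\<in>{..<n}. \<Union>j\<in>{..<n}. {(E * E) $$ (i, j) - E $$ (i, j),
      (V ^\<^sub>m N) $$ (i, j) - 1\<^sub>m n $$ (i, j), A $$ (i, j) - (E $$ (i, j) + V $$ (i, j))})"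
  have "finite S" "S \<subseteq> M" using mod by (auto simp: S_def)
  moreover have idM: "is_ideal M" using M by (simp add: is_maximal_ideal_def)
  ultimately obtain g where g: "g \<in> M" "g * g = g" "\<forall>z\<in>S. g * z = z"
    using local_unit[OF pow \<open>0 < N\<close>] by blast
  have gS: "(1 - g) * s = (1 - g) * t" if "s - t \<in> S" for s t
    using g(3) that by (auto simp: algebra_simps)
  have gE: "(1 - g) * (E * E) $$ (i, j) = (1 - g) * E $$ (i, j)"
    and gV: "(1 - g) * (V ^\<^sub>m N) $$ (i, j) = (1 - g) * 1\<^sub>m n $$ (i, j)"
    and gA: "(1 - g) * A $$ (i, j) = (1 - g) * (E $$ (i, j) + V $$ (i, j))" if "i < n" "j < n" for i j
    by (rule gS; use that in \<open>unfold S_def, blast\<close>)+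
  \<comment> \<open>On the factor of \<open>g\<close> the trivial pair \<open>0\<close>, \<open>I\<close> is used.\<close>
  let ?E = "g \<cdot>\<^sub>m 0\<^sub>m n n + (1 - g) \<cdot>\<^sub>m E" and ?V = "g \<cdot>\<^sub>m 1\<^sub>m n + (1 - g) \<cdot>\<^sub>m V"
  have "?E * ?E = g \<cdot>\<^sub>m 0\<^sub>m n n + (1 - g) \<cdot>\<^sub>m (E * E)"
    using E by (subst glue_mult[OF g(2)]) auto
  also have "\<dots> = ?E" using E gE by (intro eq_matI) (auto simp del: index_mult_mat(1))
  finally have "?E * ?E = ?E" .
  moreover have "?V ^\<^sub>m N = 1\<^sub>m n"
  proof -
    have "?V ^\<^sub>m N = g \<cdot>\<^sub>m 1\<^sub>m n + (1 - g) \<cdot>\<^sub>m (V ^\<^sub>m N)"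
      using V by (subst glue_power[OF g(2)]) (auto simp: one_pow)
    also have "\<dots> = 1\<^sub>m n"
    proof (rule eq_matI)
      fix i j assume "i < dim_row (1\<^sub>m n :: 'a mat)" "j < dim_col (1\<^sub>m n :: 'a mat)"
      then have ij: "i < n" "j < n" by simp_all
      then have "(g \<cdot>\<^sub>m 1\<^sub>m n + (1 - g) \<cdot>\<^sub>m (V ^\<^sub>m N)) $$ (i, j)
          = g * 1\<^sub>m n $$ (i, j) + (1 - g) * (V ^\<^sub>m N) $$ (i, j)"
        using pow_carrier_mat[OF V, of N] by (intro glue_index) auto
      also have "\<dots> = g * 1\<^sub>m n $$ (i, j) + (1 - g) * 1\<^sub>m n $$ (i, j)" by (simp only: gV[OF ij])
      also have "\<dots> = 1\<^sub>m n $$ (i, j)" by (simp add: left_diff_distrib)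
      finally show "(g \<cdot>\<^sub>m 1\<^sub>m n + (1 - g) \<cdot>\<^sub>m (V ^\<^sub>m N)) $$ (i, j) = 1\<^sub>m n $$ (i, j)" .
    qed (use V in auto)
    finally show ?thesis .
  qed
  moreover have "(1 - g) * (A $$ (i, j) - (?E $$ (i, j) + ?V $$ (i, j))) = 0" if ij: "i < n" "j < n" for i j
  proof -
    have "(1 - g) * (r - ((1 - g) * s + (g * d + (1 - g) * t)))
        = (1 - g) * r - (1 - g) * (s + t) + (g - g * g) * (s + t - d)" for r s t d
      by (simp add: algebra_simps)
    from this[of "A $$ (i, j)" "E $$ (i, j)" "1\<^sub>m n $$ (i, j)" "V $$ (i, j)"]
    show ?thesis using gA[OF ij] g(2) glue_index[OF _ E ij, of "0\<^sub>m n n" g] glue_index[OF _ V ij, of "1\<^sub>m n" g] ij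
      by simp
  qed
  ultimately have "good (1 - g) ?E ?V" using E V by (simp add: good_def)
  then have "1 - g \<in> M" using M(2) by (auto simp: I_def)
  then have "(1 - g) + g \<in> M" using g(1) idM unfolding is_ideal_def by blast
  then show False using M(1) by (simp add: is_maximal_ideal_def)
qed

section \<open>The residue field at a critical maximal ideal\<close>

definition defective_ideal :: "'a::comm_ring_1 set \<Rightarrow> bool" where
  "defective_ideal M \<longleftrightarrow> is_maximal_ideal M \<and>
     (\<exists>N n A. 0 < N \<and> (\<forall>x :: 'a. x ^ Suc N = x) \<and> A \<in> carrier_mat n n \<and> \<not> splits_mod M N n A)"

text \<open>The linear algebra above needs a residue field that is a type of class \<open>field\<close>, and a type cannot
depend on a maximal ideal that varies inside a proof. So one maximal ideal is fixed for each
ring, chosen to be defective if there is any defective one. Once this single ideal is known not to be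
defective, no maximal ideal is.\<close>

definition critical_ideal :: "'a::comm_ring_1 set" where
  "critical_ideal = (SOME M. is_maximal_ideal M \<and>
     ((\<exists>M' :: 'a set. defective_ideal M') \<longrightarrow> defective_ideal M))"

lemma critical_ideal:
  "is_maximal_ideal (critical_ideal :: 'a::comm_ring_1 set)"
  "defective_ideal (M :: 'a set) \<Longrightarrow> defective_ideal (critical_ideal :: 'a set)"
proof -
  have "is_ideal {0 :: 'a}" "1 \<notin> {0 :: 'a}" by (auto simp: is_ideal_def)
  then have "\<exists>M :: 'a set. is_maximal_ideal M" by (rule proper_ideal_in_maximal) blast
  then have "\<exists>M :: 'a set. is_maximal_ideal M \<and> ((\<exists>M' :: 'a set. defective_ideal M') \<longrightarrow> defective_ideal M)"
    using defective_ideal_def by blast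
  from someI_ex[OF this]
  have *: "is_maximal_ideal (critical_ideal :: 'a set) \<and>
      ((\<exists>M' :: 'a set. defective_ideal M') \<longrightarrow> defective_ideal (critical_ideal :: 'a set))"
    unfolding critical_ideal_def .
  then show "is_maximal_ideal (critical_ideal :: 'a set)" by blast
  show "defective_ideal (critical_ideal :: 'a set)" if "defective_ideal M" using * that by blast
qed

lemma critical_ideal_closed:
  fixes x y r :: "'a::comm_ring_1"
  shows "(0 :: 'a) \<in> critical_ideal"
    and "x \<in> critical_ideal \<Longrightarrow> y \<in> critical_ideal \<Longrightarrow> x + y \<in> critical_ideal"
    and "x \<in> critical_ideal \<Longrightarrow> r * x \<in> critical_ideal"
    and "x \<in> critical_ideal \<Longrightarrow> - x \<in> critical_ideal"
    and "(1 :: 'a) \<notin> critical_ideal"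
proof -
  have id: "is_ideal (critical_ideal :: 'a set)" and "(1 :: 'a) \<notin> critical_ideal"
    using critical_ideal(1) by (auto simp: is_maximal_ideal_def)
  then show "(0 :: 'a) \<in> critical_ideal" "(1 :: 'a) \<notin> critical_ideal"
    "x \<in> critical_ideal \<Longrightarrow> y \<in> critical_ideal \<Longrightarrow> x + y \<in> critical_ideal"
    "x \<in> critical_ideal \<Longrightarrow> r * x \<in> critical_ideal"
    by (auto simp: is_ideal_def)
  have "- 1 * x \<in> critical_ideal" if "x \<in> critical_ideal"
    using id that unfolding is_ideal_def by blast
  then show "x \<in> critical_ideal \<Longrightarrow> - x \<in> critical_ideal" by simp
qed

lemma critical_ideal_inverse:
  fixes x :: "'a::comm_ring_1"
  assumes "x \<notin> critical_ideal"
  shows "\<exists>y. x * y - 1 \<in> critical_ideal"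
proof -
  let ?J = "{m + x * y | m y. m \<in> critical_ideal}"
  have "is_ideal ?J"
    unfolding is_ideal_def
  proof (intro conjI ballI allI)
    show "0 \<in> ?J" using critical_ideal_closed(1) by (intro CollectI exI[of _ 0]) simp
    fix a assume "a \<in> ?J"
    then obtain m y where a: "a = m + x * y" "m \<in> critical_ideal" by blast
    then have "r * a = r * m + x * (r * y)" for r by (simp add: algebra_simps)
    then show "r * a \<in> ?J" for r using critical_ideal_closed(3)[OF a(2)] by blast
    fix b assume "b \<in> ?J"
    then obtain m' y' where b: "b = m' + x * y'" "m' \<in> critical_ideal" by blast
    then have "a + b = (m + m') + x * (y + y')" using a by (simp add: algebra_simps)
    then show "a + b \<in> ?J" using critical_ideal_closed(2)[OF a(2) b(2)] by blast
  qed
  moreover have "critical_ideal \<subseteq> ?J"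
  proof
    fix m :: 'a assume "m \<in> critical_ideal"
    then have "m = m + x * 0 \<and> m \<in> critical_ideal" by simp
    then show "m \<in> ?J" by blast
  qed
  moreover have "?J \<noteq> critical_ideal"
  proof -
    have "x = 0 + x * 1" by simp
    then have "x \<in> ?J" using critical_ideal_closed(1) by blast
    then show ?thesis using assms by blast
  qed
  ultimately have "1 \<in> ?J" using critical_ideal(1) unfolding is_maximal_ideal_def by blast
  then obtain m y where "1 = m + x * y" "m \<in> critical_ideal" by blast
  then have "x * y - 1 = - m" by (simp add: algebra_simps)
  then show ?thesis using critical_ideal_closed(4)[OF \<open>m \<in> critical_ideal\<close>] by metis
qed

quotient_type (overloaded) 'a residue = "'a::comm_ring_1" / "\<lambda>x y. x - y \<in> critical_ideal"
  morphisms rep_residue to_residue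
proof (rule equivpI)
  show "reflp (\<lambda>x y :: 'a. x - y \<in> critical_ideal)" by (simp add: reflp_def critical_ideal_closed)
  show "symp (\<lambda>x y :: 'a. x - y \<in> critical_ideal)"
  proof (rule sympI)
    fix x y :: 'a assume "x - y \<in> critical_ideal"
    from critical_ideal_closed(4)[OF this] show "y - x \<in> critical_ideal" by simp
  qed
  show "transp (\<lambda>x y :: 'a. x - y \<in> critical_ideal)"
  proof (rule transpI)
    fix x y z :: 'a assume "x - y \<in> critical_ideal" "y - z \<in> critical_ideal"
    from critical_ideal_closed(2)[OF this] show "x - z \<in> critical_ideal" by simp
  qed
qed

instantiation residue :: (comm_ring_1) field
begin

lift_definition zero_residue :: "'a residue" is 0 .
lift_definition one_residue :: "'a residue" is 1 .

lift_definition plus_residue :: "'a residue \<Rightarrow> 'a residue \<Rightarrow> 'a residue" is "(+)"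
proof -
  fix x x' y y' :: 'a assume "x - x' \<in> critical_ideal" "y - y' \<in> critical_ideal"
  from critical_ideal_closed(2)[OF this] show "x + y - (x' + y') \<in> critical_ideal" by (simp add: algebra_simps)
qed

lift_definition uminus_residue :: "'a residue \<Rightarrow> 'a residue" is uminus
proof -
  fix x x' :: 'a assume "x - x' \<in> critical_ideal"
  from critical_ideal_closed(4)[OF this] show "- x - - x' \<in> critical_ideal" by simp
qed

lift_definition times_residue :: "'a residue \<Rightarrow> 'a residue \<Rightarrow> 'a residue" is "(*)"
proof -
  fix x x' y y' :: 'a assume "x - x' \<in> critical_ideal" "y - y' \<in> critical_ideal"
  then have "y * (x - x') + x' * (y - y') \<in> critical_ideal" by (simp add: critical_ideal_closed)
  then show "x * y - x' * y' \<in> critical_ideal" by (simp add: algebra_simps)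
qed

definition minus_residue :: "'a residue \<Rightarrow> 'a residue \<Rightarrow> 'a residue" where
  "minus_residue x y = x + - y"

definition inverse_residue :: "'a residue \<Rightarrow> 'a residue" where
  "inverse_residue x = (if x = 0 then 0 else SOME y. x * y = 1)"

definition divide_residue :: "'a residue \<Rightarrow> 'a residue \<Rightarrow> 'a residue" where
  "divide_residue x y = x * inverse y"

instance
proof
  fix x y z :: "'a residue"
  show "x + y + z = x + (y + z)" by transfer (simp add: critical_ideal_closed add.assoc)
  show "x + y = y + x" by transfer (simp add: critical_ideal_closed)
  show "0 + x = x" by transfer (simp add: critical_ideal_closed)
  show "- x + x = 0" by transfer (simp add: critical_ideal_closed)
  show "x - y = x + - y" by (rule minus_residue_def)
  show "x * y * z = x * (y * z)" by transfer (simp add: critical_ideal_closed mult.assoc)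
  show comm: "x * y = y * x" for x y :: "'a residue"
    by transfer (simp add: critical_ideal_closed mult.commute)
  show "1 * x = x" by transfer (simp add: critical_ideal_closed)
  show "(x + y) * z = x * z + y * z" by transfer (simp add: critical_ideal_closed distrib_right)
  show "(0 :: 'a residue) \<noteq> 1"
    by transfer (use critical_ideal_closed(4)[of "-1"] critical_ideal_closed(5) in auto)
  show "inverse x * x = 1" if "x \<noteq> 0"
  proof -
    have "\<exists>y. x * y = 1" using that by transfer (simp add: critical_ideal_inverse)
    then have "x * (SOME y. x * y = 1) = 1" by (rule someI_ex)
    then show ?thesis using that comm[of x "inverse x"] by (simp add: inverse_residue_def)
  qed
  show "x div y = x * inverse y" by (rule divide_residue_def)
  show "inverse (0 :: 'a residue) = 0" by (simp add: inverse_residue_def)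
qed

end

lemma comm_ring_homI:
  fixes h :: "'a::comm_ring_1 \<Rightarrow> 'b::comm_ring_1"
  assumes "h 0 = 0" "h 1 = 1" "\<And>x y. h (x + y) = h x + h y" "\<And>x y. h (x * y) = h x * h y"
  shows "comm_ring_hom h"
  by unfold_locales (fact assms)+

lemma to_residue_hom: "comm_ring_hom (to_residue :: 'a::comm_ring_1 \<Rightarrow> 'a residue)"
proof (rule comm_ring_homI)
  fix x y :: 'a
  show "to_residue (x + y) = to_residue x + to_residue y" by (simp only: plus_residue.abs_eq)
  show "to_residue (x * y) = to_residue x * to_residue y" by (simp only: times_residue.abs_eq)
  show "to_residue (0 :: 'a) = 0" by (simp only: zero_residue_def)
  show "to_residue (1 :: 'a) = 1" by (simp only: one_residue_def)
qed

lemma to_residue_eq_iff: "to_residue x = to_residue y \<longleftrightarrow> x - y \<in> critical_ideal"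
  by (rule residue.abs_eq_iff)

lemma surj_to_residue: "surj to_residue"
  using Quotient_abs_rep[OF Quotient_residue] by (rule surjI)

text \<open>If the field had at most three elements, they would be \<open>0\<close>, \<open>1\<close>, \<open>-1\<close>, which are distinct as \<open>2 \<noteq> 0\<close>, and
the field would be the forbidden homomorphic image.\<close>

lemma large_if_no_F3_image:
  fixes h :: "'a::comm_ring_1 \<Rightarrow> 'f::field"
  assumes hom: "comm_ring_hom h" and "surj h" and two: "(2 :: 'f) \<noteq> 0" and F3: "\<not> has_F3_image TYPE('a)"
  shows "\<exists>a :: 'f. a \<notin> {x, y, z}"
proof (rule ccontr)
  interpret comm_ring_hom h by (rule hom)
  assume "\<nexists>a. a \<notin> {x, y, z}"
  then have UNIV: "(UNIV :: 'f set) = {x, y, z}" by (intro UNIV_eq_I) blast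
  have neg: "(1 :: 'f) \<noteq> - 1" using two by (metis add.right_inverse one_add_one)
  have fin: "finite (UNIV :: 'f set)" and "card (UNIV :: 'f set) \<le> 3"
    unfolding UNIV by (simp_all add: card_insert_if)
  moreover have "card {0, 1, - 1 :: 'f} = 3" using neg by simp
  ultimately have "{0, 1, - 1} = (UNIV :: 'f set)" by (intro card_seteq) auto
  then have all: "a = 0 \<or> a = 1 \<or> a = - 1" for a :: 'f by blast
  have double: "(1 :: 'f) + 1 = - 1"
    using all[of "1 + 1"] two by (metis add_cancel_right_right one_add_one zero_neq_one)
  then have neg_sum: "(- 1 :: 'f) + - 1 = 1" by (metis add.inverse_inverse minus_add_distrib)
  define \<psi> :: "'f \<Rightarrow> 3" where "\<psi> a = (if a = 0 then 0 else if a = 1 then 1 else - 1)" for a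
  have \<psi>: "\<psi> 0 = 0" "\<psi> 1 = 1" "\<psi> (- 1) = - 1" using neg by (auto simp: \<psi>_def)
  have three: "(1 :: 3) + 1 = - 1" "(- 1 :: 3) + - 1 = 1" by simp_all
  have add: "\<psi> (a + b) = \<psi> a + \<psi> b" for a b
    using all[of a] all[of b]
    by (elim disjE) (simp_all only: \<psi> three neg_sum double add_0_left add_0_right
        add.right_inverse add.left_inverse)
  have mult: "\<psi> (a * b) = \<psi> a * \<psi> b" for a b
    using all[of a] all[of b] \<psi> by (elim disjE) simp_all
  have "comm_ring_hom (\<lambda>r. \<psi> (h r))"
    by unfold_locales (simp_all add: hom_add hom_mult add mult \<psi>)
  moreover have "surj (\<lambda>r. \<psi> (h r))"
  proof (unfold surj_def, intro allI)
    fix c :: 3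
    have "card {0, 1, - 1 :: 3} = 3" by simp
    then have "{0, 1, - 1} = (UNIV :: 3 set)" by (intro card_seteq) auto
    then have "c = 0 \<or> c = 1 \<or> c = - 1" by blast
    then obtain a where "c = \<psi> a" using \<psi> by metis
    then show "\<exists>r. c = \<psi> (h r)" using \<open>surj h\<close> by (metis surjD)
  qed
  ultimately show False using F3 unfolding has_F3_image_def by blast
qed

text \<open>The hypotheses of the field case pass from the ring to the field: it is finite because all of its
elements are roots of \<open>t\<^sup>N\<^sup>+\<^sup>1 - t\<close>. The entries of a splitting over the field are then lifted arbitrarily.\<close>

lemma splits_mod_kernel:
  fixes h :: "'a::comm_ring_1 \<Rightarrow> 'f::field" and A :: "'a mat"
  assumes hom: "comm_ring_hom h" and surj: "surj h" and kernel: "\<And>x y. h x = h y \<longleftrightarrow> x - y \<in> M"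
    and two: "(2 :: 'a) dvd 1" and F3: "\<not> has_F3_image TYPE('a)"
    and "0 < N" and pow: "\<And>x :: 'a. x ^ Suc N = x" and A: "A \<in> carrier_mat n n"
  shows "splits_mod M N n A"
proof -
  interpret comm_ring_hom h by (rule hom)
  obtain t :: 'a where "1 = 2 * t" using two by blast
  then have "1 = 2 * h t" by (metis hom_mult hom_one hom_numeral)
  then have two': "(2 :: 'f) \<noteq> 0" by auto
  have pow': "y ^ Suc N = y" for y :: 'f
  proof -
    obtain x where "y = h x" using surj by (metis surjD)
    then show ?thesis by (metis hom_power pow)
  qed
  then have N: "y ^ N = 1" if "y \<noteq> 0" for y :: 'f
    using that by (metis mult_cancel_left mult.right_neutral power_Suc)
  let ?p = "monom 1 (Suc N) - [:0, 1:] :: 'f poly"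
  have "coeff ?p (Suc N) = 1" using \<open>0 < N\<close> by (simp add: coeff_pCons split: nat.split)
  then have "?p \<noteq> 0" by (metis coeff_0 zero_neq_one)
  then have "finite {y. poly ?p y = 0}" by (rule poly_roots_finite)
  moreover have "{y. poly ?p y = 0} = UNIV" using pow' by (simp add: poly_monom)
  ultimately have fin: "finite (UNIV :: 'f set)" by simp
  have "map_mat h A \<in> carrier_mat n n" using A by simp
  from field_mat_splits[OF two' large_if_no_F3_image[OF hom surj two' F3] N fin this]
  obtain E V where E: "E \<in> carrier_mat n n" "E * E = E" and V: "V \<in> carrier_mat n n" "V ^\<^sub>m N = 1\<^sub>m n"
    and AEV: "map_mat h A = E + V"
    by blast
  have lift: "map_mat h (map_mat (inv_into UNIV h) B) = B" for B
    by (intro eq_matI) (simp_all add: surj_f_inv_f[OF surj])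
  define E' where "E' = map_mat (inv_into UNIV h) E"
  define V' where "V' = map_mat (inv_into UNIV h) V"
  have E': "E' \<in> carrier_mat n n" "map_mat h E' = E" and V': "V' \<in> carrier_mat n n" "map_mat h V' = V"
    using E(1) V(1) lift by (simp_all add: E'_def V'_def)
  have entry: "B $$ (i, j) - C $$ (i, j) \<in> M"
    if "map_mat h B = map_mat h C" "B \<in> carrier_mat n n" "C \<in> carrier_mat n n" "i < n" "j < n"
    for B C i j
  proof -
    have "map_mat h B $$ (i, j) = map_mat h C $$ (i, j)" using that(1) by simp
    then show ?thesis using that(2-) by (simp add: kernel)
  qed
  have "map_mat h (E' * E') = map_mat h E'"
    using E'(1) by (simp add: mat_hom_mult[of _ n n _ n] E'(2) E(2))
  from entry[OF this] have 1: "(E' * E') $$ (i, j) - E' $$ (i, j) \<in> M" if "i < n" "j < n" for i j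
    using that E'(1) by (simp del: index_mult_mat)
  have "map_mat h (V' ^\<^sub>m N) = map_mat h (1\<^sub>m n)"
    using V'(1) by (simp add: mat_hom_pow[of _ n] V'(2) V(2) mat_hom_one)
  from entry[OF this] have 2: "(V' ^\<^sub>m N) $$ (i, j) - 1\<^sub>m n $$ (i, j) \<in> M" if "i < n" "j < n" for i j
    using that pow_carrier_mat[OF V'(1)] by (simp del: index_one_mat)
  have "map_mat h A = map_mat h (E' + V')"
  proof -
    have "map_mat h (E' + V') = map_mat h E' + map_mat h V'"
      using E'(1) V'(1) by (intro eq_matI) (auto simp: hom_add)
    then show ?thesis by (simp add: AEV E'(2) V'(2))
  qed
  from entry[OF this] have 3: "A $$ (i, j) - (E' $$ (i, j) + V' $$ (i, j)) \<in> M" if "i < n" "j < n" for i j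
    using that A E'(1) V'(1) by simp
  show ?thesis
    unfolding splits_mod_def using 1 2 3 E'(1) V'(1) by blast
qed

lemma maximal_ideal_not_defective:
  assumes two: "(2 :: 'a::comm_ring_1) dvd 1" and F3: "\<not> has_F3_image TYPE('a)"
  shows "\<not> defective_ideal (M :: 'a set)"
proof
  assume "defective_ideal M"
  then have "defective_ideal (critical_ideal :: 'a set)" by (rule critical_ideal(2))
  then show False
    using splits_mod_kernel[OF to_residue_hom surj_to_residue to_residue_eq_iff two F3]
    unfolding defective_ideal_def by metis
qed

section \<open>The equivalence\<close>

theorem theorem1p4:
  fixes q :: nat
  assumes "q > 1" and "odd q"
    and "CHAR('a :: comm_ring_1) \<noteq> 2"
    and "\<not> has_F3_image TYPE('a)"
    and "(of_int (int q - 1) :: 'a) dvd 1"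
  defines "P1 \<equiv> (\<forall>n>0. \<forall>A \<in> (carrier_mat n n :: 'a mat set). sum_idem_inv_q_potent q n A)"
    and "P2 \<equiv> (\<exists>n>0. \<forall>A \<in> (carrier_mat n n :: 'a mat set). sum_idem_inv_q_potent q n A)"
    and "P3 \<equiv> (\<forall>n>0. \<forall>A \<in> (carrier_mat n n :: 'a mat set). sum_idem_q_potent q n A)"
    and "P4 \<equiv> (\<exists>n>0. \<forall>A \<in> (carrier_mat n n :: 'a mat set). sum_idem_q_potent q n A)"
    and "P5 \<equiv> (\<forall>x :: 'a. x ^ q = x)"
  shows "(P1 \<longleftrightarrow> P2) \<and> (P2 \<longleftrightarrow> P3) \<and> (P3 \<longleftrightarrow> P4) \<and> (P4 \<longleftrightarrow> P5)"
proof -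
  obtain m where q: "q = Suc m" using \<open>q > 1\<close> by (cases q) auto
  have m: "0 < m" "even m" using \<open>q > 1\<close> \<open>odd q\<close> by (simp_all add: q)
  then obtain m' where m': "m = Suc m'" using gr0_implies_Suc by blast
  have unit: "(of_nat m :: 'a) dvd 1" using assms(5) by (simp add: q)
  then obtain w :: 'a where w: "w * of_nat m = 1" by (metis dvdE mult.commute)
  have "(2 :: 'a) dvd of_nat m" using m(2) by (metis evenE dvd_triv_left of_nat_mult of_nat_numeral)
  then have two: "(2 :: 'a) dvd 1" using unit dvd_trans by blast
  have P1_if_P5: P1 if P5
    unfolding P1_def
  proof (intro allI impI ballI)
    fix n :: nat and A :: "'a mat" assume A: "A \<in> carrier_mat n n"
    have pow: "x ^ Suc m = x" for x :: 'a using that by (simp add: P5_def q)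
    have "splits_mod M m n A" if "is_maximal_ideal M" for M :: "'a set"
      using maximal_ideal_not_defective[OF two assms(4), of M] that pow m(1) A
      unfolding defective_ideal_def by blast
    from splits_if_splits_mod_maximal[OF pow m(1) A this]
    obtain E V where E: "E \<in> carrier_mat n n" "E * E = E" and V: "V \<in> carrier_mat n n" "V ^\<^sub>m m = 1\<^sub>m n"
      and "A = E + V" by blast
    have "V ^\<^sub>m m' * V = 1\<^sub>m n" using V by (simp add: m')
    moreover have "V * V ^\<^sub>m k = V ^\<^sub>m k * V" for k
    proof (induction k)
      case (Suc k)
      have "V * V ^\<^sub>m Suc k = (V * V ^\<^sub>m k) * V"
        using V(1) by (simp add: assoc_mult_mat[of _ n n _ n _ n])
      then show ?case by (simp add: Suc)
    qed (use V(1) in simp)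
    ultimately have "invertible_mat V"
      unfolding invertible_mat_def inverts_mat_def using V(1) by (intro conjI exI[of _ "V ^\<^sub>m m'"]) auto
    moreover have "V ^\<^sub>m q = V" using V by (simp add: q)
    ultimately show "sum_idem_inv_q_potent q n A"
      unfolding sum_idem_inv_q_potent_def idempotent_mat_def q_potent_mat_def
      using E V(1) \<open>A = E + V\<close> by (intro bexI[of _ E] bexI[of _ V]) auto
  qed
  have P5_if_P4: P5 if P4
    unfolding P5_def
  proof
    fix x :: 'a
    obtain n where "0 < n" "\<forall>A \<in> (carrier_mat n n :: 'a mat set). sum_idem_q_potent q n A"
      using \<open>P4\<close> unfolding P4_def by blast
    then have "\<exists>e. (y ^ q - y) * (1 - e) = 0 \<and> ((y - 1) ^ q - (y - 1)) * e = 0" for y :: 'a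
      using scalar_mat_split[of n q y] by (metis one_carrier_mat smult_carrier_mat)
    then show "x ^ q = x" by (rule identity_of_scalar_splits[OF _ q m(2,1) w])
  qed
  have "sum_idem_q_potent q n A" if "sum_idem_inv_q_potent q n A" for n and A :: "'a mat"
    using that unfolding sum_idem_q_potent_def sum_idem_inv_q_potent_def by blast
  then have "P1 \<Longrightarrow> P3" "P2 \<Longrightarrow> P4" unfolding P1_def P2_def P3_def P4_def by blast+
  moreover have "P1 \<Longrightarrow> P2" "P3 \<Longrightarrow> P4" unfolding P1_def P2_def P3_def P4_def by blast+
  ultimately show ?thesis using P1_if_P5 P5_if_P4 by blast
qed

end
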